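(* Let $\alpha\le 0$ be a real constant, let $p=p(n)=n^\alpha$, and let $G\sim\vec{G}(n,p(n))$ be an Erdős–Rényi random directed graph. Let $\beta_1=\beta_1(\mathrm{dFl}(G))$ denote the first Betti number of its directed flag complex homology. Then: (a) if $-1<\alpha<-1/2$ then $\mathbb{E}[\beta_1]$ grows like $n(n-1)p$, i.e. $\lim_{n\to\infty}\mathbb{E}[\beta_1]/(n(n-1)p)=1$; (b) if $-1<\alpha<-1/2$ then $\beta_1>0$ with high probability; (c) if $\alpha<-1$ then $\beta_1=0$ with high probability; (d) if $\alpha>-1/4$ then $\beta_1=0$ with high probability.
   Context: $\vec{G}(n,p)$ is the random digraph without self-loops on vertex set $\{1,\dots,n\}$ in which each of the $n(n-1)$ possible directed edges $(i,j)$, $i\ne j$, is present independently with probability $p$ (so both $(i,j)$ and $(j,i)$ may be present). A property holds with high probability if its probability tends to $1$ as $n\to\infty$. For a digraph $G=(V,E)$, a directed $(k+1)$-clique is a tuple of distinct vertices $(v_0,\dots,v_k)$ with $(v_i,v_j)\in E$ whenever $i<j$. The directed flag chain complex (coefficients $\mathbb{Z}$) has, for $k\ge0$, $\mathrm{dFl}_k(G)$ the free $\mathbb{Z}$-module on the directed $(k+1)$-cliques, $\mathrm{dFl}_{-1}(G)=\mathbb{Z}$, boundary $\partial_k(e_{(v_0,\dots,v_k)})=\sum_{i=0}^k(-1)^i e_{(v_0,\dots,\hat{v_i},\dots,v_k)}$ for $k\ge 1$, and $\partial_0$ the sum of coefficients. $\beta_k(\mathrm{dFl}(G))$ is the rank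 of its $k$-th homology group. *)

theory Defs
  imports
    "HOL-Algebra.Free_Abelian_Groups"
    "HOL-Probability.Product_PMF"
    "Graph_Theory.Pair_Digraph"
begin

text \<open>
  One independent Bernoulli variable for each ordered pair of distinct vertices. The library's
  \<open>bernoulli_pmf\<close> truncates its parameter to the unit interval,
  so this is the intended model for \<open>0 \<le> p \<le> 1\<close>.
\<close>

definition random_digraph :: "nat \<Rightarrow> real \<Rightarrow> nat pair_pre_digraph pmf" where
  "random_digraph n p =
     map_pmf (\<lambda>present. \<lparr>pverts = {1..n}, parcs = {e. present e}\<rparr>)
       (Pi_pmf {(i, j). i \<in> {1..n} \<and> j \<in> {1..n} \<and> i \<noteq> j} False (\<lambda>_. bernoulli_pmf p))"

text \<open>
  The degree \<open>k\<close> is an integer, and a directed \<open>(k + 1)\<close>-clique is the list of its \<open>k + 1\<close>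
  vertices. In degree \<open>-1\<close> there is exactly one such list, the empty one, so that the chain group
  is infinite cyclic; below \<open>-1\<close> there are none. Since deleting the entry of a one-element list
  gives the empty list, the alternating sum of faces is in degree \<open>0\<close> the sum of coefficients,
  so no case distinction is needed in the boundary.
\<close>

definition directed_cliques :: "int \<Rightarrow> 'v pair_pre_digraph \<Rightarrow> 'v list set" where
  "directed_cliques k G =
     {vs. int (length vs) = k + 1 \<and> distinct vs \<and> set vs \<subseteq> pverts G \<and>
          (\<forall>i j. i < j \<and> j < length vs \<longrightarrow> (vs ! i, vs ! j) \<in> parcs G)}"

definition dFl :: "int \<Rightarrow> 'v pair_pre_digraph \<Rightarrow> ('v list \<Rightarrow>\<^sub>0 int) monoid" where
  "dFl k G = free_Abelian_group (directed_cliques k G)"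

definition delete_vertex :: "nat \<Rightarrow> 'v list \<Rightarrow> 'v list" where
  "delete_vertex i vs = take i vs @ drop (Suc i) vs"

definition dFl_boundary :: "('v list \<Rightarrow>\<^sub>0 int) \<Rightarrow> ('v list \<Rightarrow>\<^sub>0 int)" where
  "dFl_boundary =
     frag_extend (\<lambda>vs. \<Sum>i<length vs. frag_cmul ((-1) ^ i) (frag_of (delete_vertex i vs)))"

definition dFl_cycles :: "int \<Rightarrow> 'v pair_pre_digraph \<Rightarrow> ('v list \<Rightarrow>\<^sub>0 int) set" where
  "dFl_cycles k G = kernel (dFl k G) (dFl (k - 1) G) dFl_boundary"

definition dFl_boundaries :: "int \<Rightarrow> 'v pair_pre_digraph \<Rightarrow> ('v list \<Rightarrow>\<^sub>0 int) set" where
  "dFl_boundaries k G = dFl_boundary ` carrier (dFl (k + 1) G)"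

definition dFl_homology :: "int \<Rightarrow> 'v pair_pre_digraph \<Rightarrow> ('v list \<Rightarrow>\<^sub>0 int) set monoid" where
  "dFl_homology k G = subgroup_generated (dFl k G) (dFl_cycles k G) Mod dFl_boundaries k G"

text \<open>
  The rank of an abelian group (in multiplicative notation) is the largest size of a finite subset
  that is linearly independent over the integers. The supremum is taken in the natural numbers,
  so it is meaningful only when these sizes are bounded, as they are for finitely generated
  groups, in particular for the homology of a finite digraph.
\<close>

definition int_independent :: "('a, 'b) monoid_scheme \<Rightarrow> 'a set \<Rightarrow> bool" where
  "int_independent A B \<longleftrightarrow>
     (\<forall>c :: 'a \<Rightarrow> int. finprod A (\<lambda>x. x [^]\<^bsub>A\<^esub> c x) B = \<one>\<^bsub>A\<^esub> \<longrightarrow> (\<forall>x\<in>B. c x = 0))"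

definition abelian_rank :: "('a, 'b) monoid_scheme \<Rightarrow> nat" where
  "abelian_rank A = Sup {card B | B. finite B \<and> B \<subseteq> carrier A \<and> int_independent A B}"

definition betti :: "int \<Rightarrow> 'v pair_pre_digraph \<Rightarrow> nat" where
  "betti k G = abelian_rank (dFl_homology k G)"

end

theory Submission
  imports Defs "HOL-Real_Asymp.Real_Asymp"
begin

text \<open>
  Rank--nullity for \<open>dFl\<^sub>2 \<rightarrow> dFl\<^sub>1 \<rightarrow> dFl\<^sub>0\<close> gives
  \<open>e - n - t \<le> \<beta>\<^sub>1 \<le> e\<close>, where \<open>e\<close> and \<open>t\<close> count the arcs and the directed 3-cliques. As
  \<open>\<E> e = n (n - 1) p\<close> and \<open>\<E> t \<le> n\<^sup>3 p\<^sup>3\<close>, the terms \<open>n\<close> and \<open>t\<close> are negligible when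
  \<open>n p \<rightarrow> \<infinity>\<close> and \<open>n p\<^sup>2 \<rightarrow> 0\<close>; this gives (a), and (b) by Chebyshev's inequality for \<open>e\<close> and
  Markov's inequality for \<open>t\<close>.

  (c) A nonzero 1-cycle contains a cycle of the underlying undirected multigraph, and the expected
  number of these is at most \<open>\<Sum>\<^bsub>k\<ge>2\<^esub> (2 n p)\<^sup>k\<close>.

  (d) If \<open>n p\<^sup>4\<close> grows polynomially, any four vertices have a common out-neighbour with high
  probability. Modulo boundaries, the chain \<open>P\<^sub>w a c = (a, w) - (c, w)\<close> then does not depend on the common
  out-neighbour \<open>w\<close> of \<open>a\<close> and \<open>c\<close>, and every arc \<open>(a, b)\<close> is homologous to \<open>f a - f b\<close>, where
  \<open>f a = P\<^sub>w a r\<close> for a fixed vertex \<open>r\<close>. Hence a 1-cycle \<open>z\<close> is homologous to \<open>- f (\<partial> z) = 0\<close>.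
\<close>

section \<open>Independence over the integers modulo a subgroup\<close>

lemma subgroup_free_Abelian_groupD:
  assumes "subgroup M (free_Abelian_group S)"
  shows "0 \<in> M" and "x \<in> M \<Longrightarrow> y \<in> M \<Longrightarrow> x - y \<in> M" and "x \<in> M \<Longrightarrow> y \<in> M \<Longrightarrow> x + y \<in> M"
    and "x \<in> M \<Longrightarrow> frag_cmul k x \<in> M" and "x \<in> M \<Longrightarrow> Poly_Mapping.keys x \<subseteq> S"
proof -
  interpret subgroup M "free_Abelian_group S" by (rule assms)
  show zero: "0 \<in> M" using one_closed by simp
  show keys: "x \<in> M \<Longrightarrow> Poly_Mapping.keys x \<subseteq> S" for x using mem_carrier[of x] by simp
  show add: "x \<in> M \<Longrightarrow> y \<in> M \<Longrightarrow> x + y \<in> M" for x y using m_closed[of x y] by simp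
  have neg: "x \<in> M \<Longrightarrow> - x \<in> M" for x using m_inv_closed[of x] keys[of x] by simp
  show diff: "x \<in> M \<Longrightarrow> y \<in> M \<Longrightarrow> x - y \<in> M" for x y
    using add[of x "- y"] neg[of y] by simp
  show "x \<in> M \<Longrightarrow> frag_cmul k x \<in> M"
    by (rule frag_closure_minus_cmul[where P = "\<lambda>x. x \<in> M"]) (auto simp: zero diff)
qed

lemma subgroup_free_Abelian_groupI:
  assumes "\<And>x. x \<in> M \<Longrightarrow> Poly_Mapping.keys x \<subseteq> S" "0 \<in> M" "\<And>x y. x \<in> M \<Longrightarrow> y \<in> M \<Longrightarrow> x - y \<in> M"
  shows "subgroup M (free_Abelian_group S)"
proof
  show "M \<subseteq> carrier (free_Abelian_group S)" using assms(1) by auto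
  have neg: "- x \<in> M" if "x \<in> M" for x using assms(3)[OF assms(2) that] by simp
  show "x \<otimes>\<^bsub>free_Abelian_group S\<^esub> y \<in> M" if "x \<in> M" "y \<in> M" for x y
    using assms(3)[OF that(1) neg[OF that(2)]] by simp
  show "inv\<^bsub>free_Abelian_group S\<^esub> x \<in> M" if "x \<in> M" for x
    using assms(1)[OF that] neg[OF that] by simp
qed (use assms(2) in simp)

lemma subgroup_sum_frag_cmul:
  assumes "subgroup M (free_Abelian_group S)" "u ` I \<subseteq> M"
  shows "(\<Sum>i\<in>I. frag_cmul (c i) (u i)) \<in> M"
  using assms(2)
  by (induction I rule: infinite_finite_induct)
     (auto intro!: subgroup_free_Abelian_groupD[OF assms(1)])

text \<open>A family rather than a set: when \<open>0\<close> lies in \<open>N\<close>, a repeated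
  vector already counts as a dependence, and elimination can replace vectors without tracking
  injectivity.\<close>

definition indep_mod :: "('a \<Rightarrow>\<^sub>0 int) set \<Rightarrow> ('i \<Rightarrow> ('a \<Rightarrow>\<^sub>0 int)) \<Rightarrow> 'i set \<Rightarrow> bool" where
  "indep_mod N u I \<longleftrightarrow>
     (\<forall>c :: 'i \<Rightarrow> int. (\<Sum>i\<in>I. frag_cmul (c i) (u i)) \<in> N \<longrightarrow> (\<forall>i\<in>I. c i = 0))"

lemma indep_modI:
  assumes "\<And>c i. (\<Sum>i\<in>I. frag_cmul (c i) (u i)) \<in> N \<Longrightarrow> i \<in> I \<Longrightarrow> c i = (0 :: int)"
  shows "indep_mod N u I"
  using assms unfolding indep_mod_def by metis

lemma indep_modD:
  assumes "indep_mod N u I" "(\<Sum>i\<in>I. frag_cmul (c i) (u i)) \<in> N" "i \<in> I"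
  shows "c i = (0 :: int)"
  using assms unfolding indep_mod_def by metis

lemma indep_mod_mono: "indep_mod N u I \<Longrightarrow> N' \<subseteq> N \<Longrightarrow> indep_mod N' u I"
  unfolding indep_mod_def by blast

section \<open>Elimination over the integers\<close>

lemma frag_cmul_diff_distrib2: "frag_cmul k (a - b) = frag_cmul k a - frag_cmul k b"
  by (rule poly_mapping_eqI) (simp add: lookup_minus algebra_simps)

text \<open>One step of Gaussian elimination without division. If some \<open>u j\<close> has a
  nonzero coordinate, it serves as pivot: it is dropped, and every other vector is cross-multiplied
  with it so that its own coordinate cancels. Independence survives because the pivot coordinate is
  a nonzero integer.\<close>

lemma indep_mod_kill_coordinate:
  fixes f :: "'a \<Rightarrow> ('b \<Rightarrow>\<^sub>0 int)"
  assumes "finite (I :: 'i set)" "indep_mod N u I" "subgroup M (free_Abelian_group S)" "u ` I \<subseteq> M"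
  obtains u' and I' :: "'i set" where "finite I'" "card I \<le> card I' + 1" "indep_mod N u' I'" "u' ` I' \<subseteq> M"
    "\<forall>i\<in>I'. Poly_Mapping.lookup (frag_extend f (u' i)) a = 0"
proof -
  let ?\<phi> = "\<lambda>x. Poly_Mapping.lookup (frag_extend f x) a"
  show thesis
  proof (cases "\<forall>i\<in>I. ?\<phi> (u i) = 0")
    case True
    then show ?thesis using that[of I u] assms by simp
  next
    case False
    then obtain j where j: "j \<in> I" "?\<phi> (u j) \<noteq> 0" by blast
    define v where "v = (\<lambda>i. frag_cmul (?\<phi> (u j)) (u i) - frag_cmul (?\<phi> (u i)) (u j))"
    have "indep_mod N v (I - {j})"
      proof (rule indep_modI)
      fix c :: "_ \<Rightarrow> int" and i
      assume c: "(\<Sum>i\<in>I - {j}. frag_cmul (c i) (v i)) \<in> N" and i: "i \<in> I - {j}"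
      \<comment> \<open>\<open>d\<close> collects the coefficients of \<open>\<Sum> c\<^sub>i v\<^sub>i\<close> with respect to the family \<open>u\<close>.\<close>
      define d where "d = (\<lambda>i. if i = j then - (\<Sum>i\<in>I - {j}. c i * ?\<phi> (u i)) else c i * ?\<phi> (u j))"
      have cs: "frag_cmul (\<Sum>i\<in>K. g i) x = (\<Sum>i\<in>K. frag_cmul (g i) x)" for g :: "'i \<Rightarrow> int" and K and x :: "'a \<Rightarrow>\<^sub>0 int"
        by (induction K rule: infinite_finite_induct) (auto simp: frag_cmul_distrib)
      have "(\<Sum>i\<in>I. frag_cmul (d i) (u i)) =
            frag_cmul (d j) (u j) + (\<Sum>i\<in>I - {j}. frag_cmul (c i * ?\<phi> (u j)) (u i))"
        using j assms(1) by (subst sum.remove[of _ j]) (auto simp: d_def)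
      also have "\<dots> = (\<Sum>i\<in>I - {j}. frag_cmul (c i * ?\<phi> (u j)) (u i)) -
                        (\<Sum>i\<in>I - {j}. frag_cmul (c i * ?\<phi> (u i)) (u j))"
        by (simp add: d_def cs flip: minus_frag_cmul)
      also have "\<dots> = (\<Sum>i\<in>I - {j}. frag_cmul (c i) (v i))"
        by (simp add: v_def frag_cmul_diff_distrib2 sum_subtractf)
      finally have "(\<Sum>i\<in>I. frag_cmul (d i) (u i)) \<in> N" using c by simp
      from indep_modD[OF assms(2) this] have "d i = 0" using i by simp
      then show "c i = 0" using i j by (simp add: d_def)
    qed
    moreover have "v ` (I - {j}) \<subseteq> M"
      using assms(4) j(1) unfolding v_def
      by (auto intro!: subgroup_free_Abelian_groupD[OF assms(3)])
    moreover have "\<forall>i\<in>I - {j}. ?\<phi> (v i) = 0"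
      by (simp add: v_def frag_extend_diff frag_extend_cmul lookup_minus)
    moreover have "card I \<le> card (I - {j}) + 1" using j(1) assms(1) by simp
    ultimately show ?thesis using that[of "I - {j}" v] assms(1) by blast
  qed
qed

text \<open>The rank-nullity inequality: passing to vectors whose image under the extension of
  \<open>f\<close> vanishes on \<open>A\<close> costs at most one index for each element of
  \<open>A\<close>.\<close>

lemma indep_mod_kill_coordinates:
  fixes f :: "'a \<Rightarrow> ('b \<Rightarrow>\<^sub>0 int)"
  assumes "finite A" "finite (I :: 'i set)" "indep_mod N u I" "subgroup M (free_Abelian_group S)" "u ` I \<subseteq> M"
  shows "\<exists>u' (I' :: 'i set). finite I' \<and> card I \<le> card I' + card A \<and> indep_mod N u' I' \<and> u' ` I' \<subseteq> M \<and>
           (\<forall>i\<in>I'. \<forall>a\<in>A. Poly_Mapping.lookup (frag_extend f (u' i)) a = 0)"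
  using assms
proof (induction A arbitrary: u I M rule: finite_induct)
  case empty
  then show ?case by (intro exI[of _ u] exI[of _ I] conjI) simp_all
next
  case (insert a A)
  obtain u' and I' :: "'i set" where 1: "finite I'" "card I \<le> card I' + 1" "indep_mod N u' I'" "u' ` I' \<subseteq> M"
    "\<forall>i\<in>I'. Poly_Mapping.lookup (frag_extend f (u' i)) a = 0"
    by (rule indep_mod_kill_coordinate[OF insert.prems])
  \<comment> \<open>Shrinking \<open>M\<close> to the kernel of the coordinate \<open>a\<close>
    makes the induction hypothesis preserve the vanishing already achieved there.\<close>
  let ?M = "M \<inter> {x. Poly_Mapping.lookup (frag_extend f x) a = 0}"
  have sub: "subgroup ?M (free_Abelian_group S)"
    using subgroup_free_Abelian_groupD[OF insert.prems(3)]
    by (intro subgroup_free_Abelian_groupI) (auto simp: frag_extend_diff lookup_minus)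
  have im: "u' ` I' \<subseteq> ?M" using 1 by auto
  from insert.IH[OF 1(1,3) sub im] obtain u'' and I'' :: "'i set" where 2: "finite I''" "card I' \<le> card I'' + card A" "indep_mod N u'' I''"
    "u'' ` I'' \<subseteq> ?M" "\<forall>i\<in>I''. \<forall>a\<in>A. Poly_Mapping.lookup (frag_extend f (u'' i)) a = 0"
    by (elim exE conjE) (rule that)
  show ?case
    using 1 2 insert.hyps by (intro exI[of _ u''] exI[of _ I'']) (auto simp: image_subset_iff)
qed

text \<open>Extending \<open>frag_of\<close> gives the identity, so killing all coordinates in
  \<open>S\<close> leaves only zero vectors, and an independent family of zero vectors has no
  members.\<close>

lemma indep_mod_zero_card_le:
  assumes "finite (I :: 'i set)" "finite S" "indep_mod {0} u I" "\<And>i. i \<in> I \<Longrightarrow> Poly_Mapping.keys (u i) \<subseteq> S"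
  shows "card I \<le> card S"
proof -
  have sub: "subgroup (carrier (free_Abelian_group S)) (free_Abelian_group S)"
    by (simp add: group.subgroup_self)
  have im: "u ` I \<subseteq> carrier (free_Abelian_group S)" using assms(4) by auto
  from indep_mod_kill_coordinates[OF assms(2,1,3) sub im, where f = frag_of]
  obtain u' and I' :: "'i set" where 1: "finite I'" "card I \<le> card I' + card S" "indep_mod {0} u' I'"
    "u' ` I' \<subseteq> carrier (free_Abelian_group S)"
    "\<forall>i\<in>I'. \<forall>a\<in>S. Poly_Mapping.lookup (frag_extend frag_of (u' i)) a = 0"
    by (elim exE conjE) (rule that)
  have "u' i = 0" if "i \<in> I'" for i
  proof -
    have "Poly_Mapping.keys (u' i) \<subseteq> S" using 1(4) that by (simp add: image_subset_iff)
    moreover have "a \<notin> Poly_Mapping.keys (u' i)" if "a \<in> S" for a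
      using 1(5) that \<open>i \<in> I'\<close> frag_expansion[of "u' i"] by (metis in_keys_iff)
    ultimately have "Poly_Mapping.keys (u' i) = {}" by blast
    then show ?thesis by simp
  qed
  then have "I' = {}"
    using indep_modD[OF 1(3), of "\<lambda>_. 1"] by auto
  then show ?thesis using 1(2) by simp
qed

text \<open>Each relation \<open>f t\<close> lowers the rank by at most one. If adding it makes the
  family dependent, an index with nonzero coefficient in such a dependence is dropped; a second
  dependence among the rest could be combined with the first to cancel \<open>f t\<close>,
  contradicting independence before \<open>t\<close> was added.\<close>

lemma indep_mod_relations:
  fixes f :: "'a \<Rightarrow> ('b \<Rightarrow>\<^sub>0 int)"
  assumes "finite T" "finite I" "indep_mod {0} u I"
  shows "\<exists>J\<subseteq>I. card I \<le> card J + card T \<and> indep_mod (frag_extend f ` carrier (free_Abelian_group T)) u J"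
  using assms(1)
proof (induction T rule: finite_induct)
  case empty
  have "frag_extend f ` carrier (free_Abelian_group {}) = {0}"
    by (auto simp: free_Abelian_group_def)
  then show ?case using assms by auto
next
  case (insert t T)
  let ?N = "\<lambda>T. frag_extend f ` carrier (free_Abelian_group T)"
  obtain J where J: "J \<subseteq> I" "card I \<le> card J + card T" "indep_mod (?N T) u J"
    using insert.IH by blast
  have finJ: "finite J" using J(1) assms(2) finite_subset by blast
  have split: "\<exists>k. \<exists>y \<in> ?N T. x = y + frag_cmul k (f t)" if x: "x \<in> ?N (insert t T)" for x
  proof -
    obtain z where z: "x = frag_extend f z" "Poly_Mapping.keys z \<subseteq> insert t T" using x by auto
    let ?k = "Poly_Mapping.lookup z t"
    let ?y = "z - frag_cmul ?k (frag_of t)"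
    have "Poly_Mapping.keys ?y \<subseteq> T"
      using z(2) by (auto simp: in_keys_iff lookup_minus lookup_single when_def split: if_splits)
    moreover have "x = frag_extend f ?y + frag_cmul ?k (f t)"
      by (simp add: z(1) frag_extend_diff frag_extend_cmul)
    ultimately show ?thesis
      by (intro exI[of _ ?k] bexI[of _ "frag_extend f ?y"] image_eqI[OF refl]) auto
  qed
  have subT: "subgroup (?N T) (free_Abelian_group UNIV)"
  proof (rule subgroup_free_Abelian_groupI)
    show "0 \<in> ?N T" by (rule image_eqI[of _ _ 0]) auto
    fix x y assume "x \<in> ?N T" "y \<in> ?N T"
    then obtain x' y' where "x = frag_extend f x'" "y = frag_extend f y'"
      "Poly_Mapping.keys x' \<subseteq> T" "Poly_Mapping.keys y' \<subseteq> T" by auto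
    then show "x - y \<in> ?N T"
      using keys_diff[of x' y'] by (intro image_eqI[of _ _ "x' - y'"]) (auto simp: frag_extend_diff)
  qed auto
  show ?case
  proof (cases "indep_mod (?N (insert t T)) u J")
    case True
    then show ?thesis using J insert.hyps by (intro exI[of _ J]) auto
  next
    case False
    then obtain c j where c: "(\<Sum>i\<in>J. frag_cmul (c i) (u i)) \<in> ?N (insert t T)" and j: "j \<in> J" "c j \<noteq> 0"
      unfolding indep_mod_def by blast
    obtain k y where ky: "y \<in> ?N T" "(\<Sum>i\<in>J. frag_cmul (c i) (u i)) = y + frag_cmul k (f t)"
      using split[OF c] by blast
    have "indep_mod (?N (insert t T)) u (J - {j})"
      proof (rule indep_modI)
      fix d :: "_ \<Rightarrow> int" and i
      assume d: "(\<Sum>i\<in>J - {j}. frag_cmul (d i) (u i)) \<in> ?N (insert t T)" and i: "i \<in> J - {j}"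
      obtain l z where lz: "z \<in> ?N T" "(\<Sum>i\<in>J - {j}. frag_cmul (d i) (u i)) = z + frag_cmul l (f t)"
        using split[OF d] by blast
      define d' where "d' = (\<lambda>i. if i = j then 0 else d i)"
      have d': "(\<Sum>i\<in>J. frag_cmul (d' i) (u i)) = z + frag_cmul l (f t)"
        using lz(2) finJ j(1) by (subst sum.remove[of _ j]) (auto simp: d'_def)
      \<comment> \<open>Eliminate \<open>f t\<close> from the two relations.\<close>
      have "(\<Sum>i\<in>J. frag_cmul (k * d' i - l * c i) (u i)) =
            frag_cmul k (\<Sum>i\<in>J. frag_cmul (d' i) (u i)) - frag_cmul l (\<Sum>i\<in>J. frag_cmul (c i) (u i))"
        by (simp add: frag_cmul_sum frag_cmul_diff_distrib sum_subtractf)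
      also have "\<dots> = frag_cmul k z - frag_cmul l y"
        by (simp only: d' ky(2) frag_cmul_distrib2 frag_cmul_cmul mult.commute[of l]) simp
      also have "\<dots> \<in> ?N T"
        using ky(1) lz(1) by (intro subgroup_free_Abelian_groupD[OF subT])
      \<comment> \<open>Since \<open>d'\<close> vanishes at the dropped index \<open>j\<close>, this
        coefficient is \<open>- l * c j\<close>, which forces \<open>l = 0\<close>; the second
        relation then does not involve \<open>f t\<close>.\<close>
      finally have "k * d' j - l * c j = 0"
        by (rule indep_modD[OF J(3) _ j(1)])
      then have "l = 0" using j(2) by (simp add: d'_def)
      then have "(\<Sum>i\<in>J. frag_cmul (d' i) (u i)) \<in> ?N T" using d' lz(1) by simp
      from indep_modD[OF J(3) this] have "d' i = 0" using i by simp
      then show "d i = 0" using i by (simp add: d'_def)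
    qed
    moreover have "card J = card (J - {j}) + 1" using j(1) finJ card_Suc_Diff1[of J j] by simp
    ultimately show ?thesis
      using J insert.hyps by (intro exI[of _ "J - {j}"]) auto
  qed
qed

section \<open>The rank of a quotient of a free abelian group\<close>

lemma abelian_rank_le:
  assumes "\<And>B. finite B \<Longrightarrow> B \<subseteq> carrier A \<Longrightarrow> int_independent A B \<Longrightarrow> card B \<le> m"
  shows "abelian_rank A \<le> m"
proof -
  have "int_independent A {}" by (simp add: int_independent_def)
  \<comment> \<open>The empty set shows that there is at least one size, as
    \<open>cSup_least\<close> requires.\<close>
  then have "0 \<in> {card B |B. finite B \<and> B \<subseteq> carrier A \<and> int_independent A B}"
    by (intro CollectI exI[of _ "{}"]) simp
  then show ?thesis
    unfolding abelian_rank_def using assms by (intro cSup_least) auto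
qed

text \<open>The uniform bound \<open>m\<close> is what gives the supremum of natural numbers its
  meaning as an upper bound.\<close>

lemma card_le_abelian_rank:
  assumes "\<And>B. finite B \<Longrightarrow> B \<subseteq> carrier A \<Longrightarrow> int_independent A B \<Longrightarrow> card B \<le> m"
    and "finite B" "B \<subseteq> carrier A" "int_independent A B"
  shows "card B \<le> abelian_rank A"
  unfolding abelian_rank_def
proof (rule cSup_upper)
  show "card B \<in> {card B |B. finite B \<and> B \<subseteq> carrier A \<and> int_independent A B}"
    by (intro CollectI exI[of _ B]) (simp add: assms(2-))
  show "bdd_above {card B |B. finite B \<and> B \<subseteq> carrier A \<and> int_independent A B}"
    using assms(1) by (intro bdd_aboveI[of _ m]) auto
qed

section \<open>Independent sets in the quotient of \<open>Z\<close> by \<open>N\<close> versus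
  families independent modulo \<open>N\<close>\<close>

context
  fixes S :: "'a set" and Z N :: "('a \<Rightarrow>\<^sub>0 int) set"
  assumes Z: "subgroup Z (free_Abelian_group S)"
    and N: "subgroup N (free_Abelian_group S)"
    and NZ: "N \<subseteq> Z"
begin

abbreviation (input) "frag_sub \<equiv> subgroup_generated (free_Abelian_group S) Z"
abbreviation (input) "frag_quot \<equiv> frag_sub Mod N"
abbreviation (input) "frag_coset \<equiv> \<lambda>x. N #>\<^bsub>frag_sub\<^esub> x"

lemma carrier_frag_sub: "carrier frag_sub = Z"
  using subgroup.carrier_subgroup_generated_subgroup[OF Z] .

lemma comm_group_frag_sub: "comm_group frag_sub"
  by (simp add: group.abelian_subgroup_generated abelian_free_Abelian_group)

lemma normal_frag_sub: "N \<lhd> frag_sub"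
proof -
  have "subgroup N frag_sub"
    by (rule group.subgroup_of_subgroup_generated[OF group_free_Abelian_group NZ N])
  then show ?thesis
    by (simp add: comm_group.normal_iff_subgroup[OF comm_group_frag_sub])
qed

lemma comm_group_frag_quot: "comm_group frag_quot"
  by (rule comm_group.abelian_FactGroup[OF comm_group_frag_sub normal_imp_subgroup[OF normal_frag_sub]])

lemma frag_coset_hom: "group_hom frag_sub frag_quot frag_coset"
  using comm_group_frag_sub comm_group_frag_quot normal.r_coset_hom_Mod[OF normal_frag_sub]
  by (auto simp: group_hom_def group_hom_axioms_def comm_group_def)

lemma carrier_frag_quot: "carrier frag_quot = frag_coset ` Z"
  by (auto simp: FactGroup_def RCOSETS_def carrier_frag_sub)

lemma frag_coset_eq_one_iff: "x \<in> Z \<Longrightarrow> frag_coset x = \<one>\<^bsub>frag_quot\<^esub> \<longleftrightarrow> x \<in> N"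
proof -
  assume x: "x \<in> Z"
  have g: "group frag_sub" by (rule group.group_subgroup_generated[OF group_free_Abelian_group])
  have s: "subgroup N frag_sub" by (rule normal_imp_subgroup[OF normal_frag_sub])
  show ?thesis
    using x subgroup.rcos_const[OF s g] group.coset_join1[OF g _ _ s, of x]
      subgroup.subset[OF s]
    by (auto simp: FactGroup_def carrier_frag_sub)
qed

lemma frag_coset_int_pow:
  assumes "x \<in> Z"
  shows "frag_coset x [^]\<^bsub>frag_quot\<^esub> (k :: int) = frag_coset (frag_cmul k x)"
proof -
  have "x [^]\<^bsub>frag_sub\<^esub> k = frag_cmul k x"
  proof -
    have "x [^]\<^bsub>frag_sub\<^esub> k = x [^]\<^bsub>free_Abelian_group S\<^esub> k"
      using assms subgroup.carrier_subgroup_generated_subgroup[OF Z]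
      by (metis group.int_pow_subgroup_generated group_free_Abelian_group)
    then show ?thesis using subgroup_free_Abelian_groupD(5)[OF Z assms] by simp
  qed
  then show ?thesis
    using group_hom.hom_int_pow[OF frag_coset_hom, of x k] assms carrier_frag_sub by simp
qed

text \<open>Translates the multiplicative notation of the quotient into integer combinations of
  representatives, so that relations in the quotient become membership in \<open>N\<close>.\<close>

lemma frag_coset_finprod:
  assumes "finite I" "u ` I \<subseteq> Z"
  shows "finprod frag_quot (\<lambda>i. frag_coset (u i) [^]\<^bsub>frag_quot\<^esub> (c i :: int)) I =
           frag_coset (\<Sum>i\<in>I. frag_cmul (c i) (u i))"
  using assms
proof (induction I rule: finite_induct)
  case empty
  interpret Q: comm_group frag_quot by (rule comm_group_frag_quot)
  show ?case
    using frag_coset_eq_one_iff[of 0] subgroup_free_Abelian_groupD(1)[OF N]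
      subgroup_free_Abelian_groupD(1)[OF Z] by simp
next
  case (insert j I)
  interpret Q: comm_group frag_quot by (rule comm_group_frag_quot)
  have cl: "frag_coset x \<in> carrier frag_quot" if "x \<in> Z" for x
    using that carrier_frag_quot by blast
  have j: "frag_cmul (c j) (u j) \<in> Z"
    using insert.prems subgroup_free_Abelian_groupD(4)[OF Z] by simp
  have s: "(\<Sum>i\<in>I. frag_cmul (c i) (u i)) \<in> Z"
    using subgroup_sum_frag_cmul[OF Z, of u I c] insert.prems by simp
  have "finprod frag_quot (\<lambda>i. frag_coset (u i) [^]\<^bsub>frag_quot\<^esub> c i) (insert j I) =
        (frag_coset (u j) [^]\<^bsub>frag_quot\<^esub> c j) \<otimes>\<^bsub>frag_quot\<^esub>
          finprod frag_quot (\<lambda>i. frag_coset (u i) [^]\<^bsub>frag_quot\<^esub> c i) I"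
    using insert.hyps insert.prems
    by (intro Q.finprod_insert) (auto intro!: Q.int_pow_closed cl)
  also have "\<dots> = frag_coset (frag_cmul (c j) (u j)) \<otimes>\<^bsub>frag_quot\<^esub>
                   frag_coset (\<Sum>i\<in>I. frag_cmul (c i) (u i))"
    using insert.IH insert.prems frag_coset_int_pow[of "u j" "c j"] by simp
  also have "\<dots> = frag_coset (\<Sum>i\<in>insert j I. frag_cmul (c i) (u i))"
    using group_hom.hom_mult[OF frag_coset_hom, of "frag_cmul (c j) (u j)" "\<Sum>i\<in>I. frag_cmul (c i) (u i)"]
      j s insert.hyps by (simp add: carrier_frag_sub)
  finally show ?case .
qed

lemma finprod_eq_one_iff:
  assumes "finite I" "u ` I \<subseteq> Z"
  shows "finprod frag_quot (\<lambda>i. frag_coset (u i) [^]\<^bsub>frag_quot\<^esub> (c i :: int)) I = \<one>\<^bsub>frag_quot\<^esub>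
           \<longleftrightarrow> (\<Sum>i\<in>I. frag_cmul (c i) (u i)) \<in> N"
  using frag_coset_finprod[OF assms] frag_coset_eq_one_iff subgroup_sum_frag_cmul[OF Z assms(2)] by metis

lemma int_independent_imp_indep_mod:
  assumes "finite B" "B \<subseteq> carrier frag_quot" "int_independent frag_quot B"
  obtains u where "u ` B \<subseteq> Z" "indep_mod N u B"
proof -
  interpret Q: comm_group frag_quot by (rule comm_group_frag_quot)
  have "\<forall>X\<in>B. \<exists>x\<in>Z. X = frag_coset x" using assms(2) carrier_frag_quot by auto
  then obtain u where u: "\<And>X. X \<in> B \<Longrightarrow> u X \<in> Z \<and> X = frag_coset (u X)" by metis
  have uZ: "u ` B \<subseteq> Z" using u by auto
  have "indep_mod N u B"
  proof (rule indep_modI)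
    fix c :: "_ \<Rightarrow> int" and X
    assume c: "(\<Sum>X\<in>B. frag_cmul (c X) (u X)) \<in> N" and X: "X \<in> B"
    have "finprod frag_quot (\<lambda>X. X [^]\<^bsub>frag_quot\<^esub> c X) B =
          finprod frag_quot (\<lambda>X. frag_coset (u X) [^]\<^bsub>frag_quot\<^esub> c X) B"
      using u assms(2) by (intro Q.finprod_cong') (auto intro!: Q.int_pow_closed)
    then have "finprod frag_quot (\<lambda>X. X [^]\<^bsub>frag_quot\<^esub> c X) B = \<one>\<^bsub>frag_quot\<^esub>"
      using finprod_eq_one_iff[OF assms(1) uZ] c by simp
    then show "c X = 0" using assms(3) X unfolding int_independent_def by blast
  qed
  then show ?thesis using that uZ by blast
qed

text \<open>Since \<open>int_independent\<close> speaks of sets, the cosets of the family must be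
  distinct. If two of them coincided, the difference of the representatives would lie in
  \<open>N\<close>, a relation with coefficients 1 and -1.\<close>

lemma indep_mod_imp_int_independent:
  assumes "finite I" "u ` I \<subseteq> Z" "indep_mod N u I"
  obtains B where "finite B" "B \<subseteq> carrier frag_quot" "int_independent frag_quot B" "card B = card I"
proof -
  interpret Q: comm_group frag_quot by (rule comm_group_frag_quot)
  interpret h: group_hom frag_sub frag_quot frag_coset by (rule frag_coset_hom)
  let ?q = "\<lambda>i. frag_coset (u i)"
  have uZ: "u i \<in> Z" if "i \<in> I" for i using assms(2) that by auto
  have cl: "?q i \<in> carrier frag_quot" if "i \<in> I" for i using uZ[OF that] carrier_frag_quot by blast
  have inj: "inj_on ?q I"
  proof (rule inj_onI, rule ccontr)
    fix i j assume ij: "i \<in> I" "j \<in> I" "?q i = ?q j" "i \<noteq> j"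
    define c where "c = (\<lambda>k. if k = i then 1 else if k = j then - 1 else (0 :: int))"
    have "(\<Sum>k\<in>I. frag_cmul (c k) (u k)) = (\<Sum>k\<in>{i, j}. frag_cmul (c k) (u k))"
      using ij assms(1) by (intro sum.mono_neutral_right) (auto simp: c_def)
    also have "\<dots> = u i - u j" using ij by (simp add: c_def)
    finally have eq: "(\<Sum>k\<in>I. frag_cmul (c k) (u k)) = u i - u j" .
    have "u i - u j \<in> Z" using uZ ij subgroup_free_Abelian_groupD(2)[OF Z] by blast
    have "frag_coset (u j + (u i - u j)) = ?q j \<otimes>\<^bsub>frag_quot\<^esub> frag_coset (u i - u j)"
      using h.hom_mult[of "u j" "u i - u j"] \<open>u i - u j \<in> Z\<close> uZ ij(2)
      by (simp add: carrier_frag_sub)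
    then have eq': "?q j = ?q j \<otimes>\<^bsub>frag_quot\<^esub> frag_coset (u i - u j)" using ij(3) by simp
    have cl': "frag_coset (u i - u j) \<in> carrier frag_quot"
      using \<open>u i - u j \<in> Z\<close> carrier_frag_quot by blast
    have "frag_coset (u i - u j) = \<one>\<^bsub>frag_quot\<^esub>"
      by (rule iffD1[OF Q.l_cancel_one'[OF cl[OF ij(2)] cl'] eq'])
    then have "u i - u j \<in> N" using frag_coset_eq_one_iff \<open>u i - u j \<in> Z\<close> by blast
    then have "c i = 0" using indep_modD[OF assms(3), of c i] eq ij(1) by simp
    then show False by (simp add: c_def)
  qed
  have "int_independent frag_quot (?q ` I)"
    unfolding int_independent_def
  proof (intro allI impI)
    fix c :: "_ \<Rightarrow> int"
    assume c: "finprod frag_quot (\<lambda>X. X [^]\<^bsub>frag_quot\<^esub> c X) (?q ` I) = \<one>\<^bsub>frag_quot\<^esub>"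
    have "finprod frag_quot (\<lambda>X. X [^]\<^bsub>frag_quot\<^esub> c X) (?q ` I) =
          finprod frag_quot (\<lambda>i. ?q i [^]\<^bsub>frag_quot\<^esub> c (?q i)) I"
      using cl inj by (intro Q.finprod_reindex) (auto intro!: Q.int_pow_closed)
    then have "(\<Sum>i\<in>I. frag_cmul (c (?q i)) (u i)) \<in> N"
      using finprod_eq_one_iff[OF assms(1,2), of "\<lambda>i. c (?q i)"] c by simp
    from indep_modD[OF assms(3) this] show "\<forall>X\<in>?q ` I. c X = 0" by blast
  qed
  then show ?thesis
    using that[of "?q ` I"] assms(1) cl card_image[OF inj] by blast
qed

text \<open>Independence modulo \<open>N\<close> implies independence modulo zero, so the rank of
  the ambient free group bounds the rank of the subquotient.\<close>

lemma card_int_independent_le: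
  assumes "finite S" "finite B" "B \<subseteq> carrier frag_quot" "int_independent frag_quot B"
  shows "card B \<le> card S"
proof -
  obtain u where u: "u ` B \<subseteq> Z" "indep_mod N u B"
    using int_independent_imp_indep_mod[OF assms(2-4)] .
  have "indep_mod {0} u B"
    using indep_mod_mono[OF u(2), of "{0}"] subgroup_free_Abelian_groupD(1)[OF N] by simp
  moreover have "Poly_Mapping.keys (u X) \<subseteq> S" if "X \<in> B" for X
    using subgroup_free_Abelian_groupD(5)[OF Z, of "u X"] u(1) that by auto
  ultimately show ?thesis by (rule indep_mod_zero_card_le[OF assms(2,1)])
qed

lemma abelian_rank_frag_quot_le:
  assumes "finite S"
  shows "abelian_rank frag_quot \<le> card S"
  by (rule abelian_rank_le) (rule card_int_independent_le[OF assms])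

lemma card_le_abelian_rank_frag_quot:
  assumes "finite S" "finite I" "u ` I \<subseteq> Z" "indep_mod N u I"
  shows "card I \<le> abelian_rank frag_quot"
proof -
  obtain B where B: "finite B" "B \<subseteq> carrier frag_quot" "int_independent frag_quot B" "card B = card I"
    using indep_mod_imp_int_independent[OF assms(2-4)] .
  from card_le_abelian_rank[OF card_int_independent_le[OF assms(1)] B(1-3)] show ?thesis
    using B(4) by simp
qed

lemma abelian_rank_frag_quot_eq_0:
  assumes "Z \<subseteq> N"
  shows "abelian_rank frag_quot = 0"
proof -
  have "card B = 0" if B: "finite B" "B \<subseteq> carrier frag_quot" "int_independent frag_quot B" for B
  proof -
    obtain u where u: "u ` B \<subseteq> Z" "indep_mod N u B"
      using int_independent_imp_indep_mod[OF B] .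
    \<comment> \<open>With all coefficients equal to 1 the sum lies in \<open>N\<close>, so
      independence leaves no room for a member of \<open>B\<close>.\<close>
    have "(\<Sum>i\<in>B. frag_cmul 1 (u i)) \<in> N"
      using subgroup_sum_frag_cmul[OF N, of u B "\<lambda>_. 1"] u(1) assms by blast
    then have "B = {}" using indep_modD[OF u(2), of "\<lambda>_. 1"] by fastforce
    then show ?thesis by simp
  qed
  then have "abelian_rank frag_quot \<le> 0" by (intro abelian_rank_le) auto
  then show ?thesis by simp
qed

end

section \<open>The directed flag complex\<close>

text \<open>The form with \<open>sorted_wrt\<close> evaluates by simplification on explicit lists
  and splits along appends.\<close>

lemma directed_cliques_altdef:
  "directed_cliques k G =
     {vs. int (length vs) = k + 1 \<and> distinct vs \<and> set vs \<subseteq> pverts G \<and>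
          sorted_wrt (\<lambda>v w. (v, w) \<in> parcs G) vs}"
  unfolding directed_cliques_def sorted_wrt_iff_nth_less by blast

lemma finite_directed_cliques:
  assumes "finite (pverts G)"
  shows "finite (directed_cliques k G)"
proof (rule finite_subset)
  show "directed_cliques k G \<subseteq> {vs. set vs \<subseteq> pverts G \<and> distinct vs}"
    by (auto simp: directed_cliques_def)
  show "finite {vs. set vs \<subseteq> pverts G \<and> distinct vs}"
    using finite_subset_distinct[OF assms] .
qed

lemma delete_vertex_in_directed_cliques:
  assumes "vs \<in> directed_cliques (k + 1) G" "i < length vs"
  shows "delete_vertex i vs \<in> directed_cliques k G"
proof -
  have vs: "vs = take i vs @ vs ! i # drop (Suc i) vs"
    using assms(2) by (rule id_take_nth_drop)
  define ys zs where "ys = take i vs" and "zs = drop (Suc i) vs"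
  have "ys @ vs ! i # zs \<in> directed_cliques (k + 1) G"
    using assms(1) vs by (simp add: ys_def zs_def)
  then have "ys @ zs \<in> directed_cliques k G"
    unfolding directed_cliques_altdef by (auto simp: sorted_wrt_append)
  then show ?thesis by (simp add: delete_vertex_def ys_def zs_def)
qed

lemma keys_dFl_boundary:
  assumes "Poly_Mapping.keys x \<subseteq> directed_cliques (k + 1) G"
  shows "Poly_Mapping.keys (dFl_boundary x) \<subseteq> directed_cliques k G"
proof -
  have "Poly_Mapping.keys (\<Sum>i<length vs. frag_cmul ((-1) ^ i) (frag_of (delete_vertex i vs)))
          \<subseteq> directed_cliques k G" if vs: "vs \<in> directed_cliques (k + 1) G" for vs
  proof -
    have "Poly_Mapping.keys (\<Sum>i\<in>{..<length vs}. frag_cmul ((-1) ^ i) (frag_of (delete_vertex i vs)))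
            \<subseteq> (\<Union>i\<in>{..<length vs}. Poly_Mapping.keys (frag_cmul ((-1) ^ i) (frag_of (delete_vertex i vs))))"
      by (rule keys_sum)
    also have "\<dots> \<subseteq> directed_cliques k G"
      using delete_vertex_in_directed_cliques[OF vs] by (auto simp: keys_frag_of)
    finally show ?thesis .
  qed
  then show ?thesis
    using assms unfolding dFl_boundary_def
    by (intro subset_trans[OF keys_frag_extend] UN_least) auto
qed

lemma dFl_cycles_eq:
  "dFl_cycles k G = {x. Poly_Mapping.keys x \<subseteq> directed_cliques k G \<and> dFl_boundary x = 0}"
  by (simp add: dFl_cycles_def kernel_def dFl_def)

lemma dFl_boundary_diff: "dFl_boundary (x - y) = dFl_boundary x - dFl_boundary y"
  by (simp add: dFl_boundary_def frag_extend_diff)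

lemma dFl_boundary_add: "dFl_boundary (x + y) = dFl_boundary x + dFl_boundary y"
  by (simp add: dFl_boundary_def frag_extend_add)

lemma dFl_boundary_0 [simp]: "dFl_boundary 0 = 0"
  by (simp add: dFl_boundary_def)

lemma subgroup_dFl_cycles: "subgroup (dFl_cycles k G) (dFl k G)"
  unfolding dFl_def
proof (rule subgroup_free_Abelian_groupI)
  fix x y assume "x \<in> dFl_cycles k G" "y \<in> dFl_cycles k G"
  then show "x - y \<in> dFl_cycles k G"
    using keys_diff[of x y] by (auto simp: dFl_cycles_eq dFl_boundary_diff)
qed (auto simp: dFl_cycles_eq)

lemma subgroup_dFl_boundaries: "subgroup (dFl_boundaries k G) (dFl k G)"
  unfolding dFl_def
proof (rule subgroup_free_Abelian_groupI)
  show "0 \<in> dFl_boundaries k G"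
    unfolding dFl_boundaries_def dFl_def by (rule image_eqI[of _ _ 0]) simp_all
  fix x assume "x \<in> dFl_boundaries k G"
  then show "Poly_Mapping.keys x \<subseteq> directed_cliques k G"
    unfolding dFl_boundaries_def dFl_def by (auto dest!: keys_dFl_boundary)
next
  fix x y assume "x \<in> dFl_boundaries k G" "y \<in> dFl_boundaries k G"
  then obtain x' y' where "x = dFl_boundary x'" "y = dFl_boundary y'"
    "Poly_Mapping.keys x' \<subseteq> directed_cliques (k + 1) G"
    "Poly_Mapping.keys y' \<subseteq> directed_cliques (k + 1) G"
    unfolding dFl_boundaries_def dFl_def by auto
  then show "x - y \<in> dFl_boundaries k G"
    unfolding dFl_boundaries_def dFl_def using keys_diff[of x' y']
    by (intro image_eqI[of _ _ "x' - y'"]) (auto simp: dFl_boundary_diff)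
qed

section \<open>Boundaries in low degrees and bounds on the first Betti number\<close>

lemma dFl_boundary_2: "dFl_boundary (frag_of [a, b]) = frag_of [b] - frag_of [a]"
  by (simp add: dFl_boundary_def delete_vertex_def lessThan_Suc numeral_2_eq_2)

lemma dFl_boundary_3:
  "dFl_boundary (frag_of [a, b, c]) = frag_of [b, c] - frag_of [a, c] + frag_of [a, b]"
  by (simp add: dFl_boundary_def delete_vertex_def lessThan_Suc numeral_3_eq_3)

lemma length_3_conv: "length xs = 3 \<longleftrightarrow> (\<exists>a b c. xs = [a, b, c])"
  by (auto simp: numeral_3_eq_3 length_Suc_conv)

text \<open>Two successive boundaries cancel: in this degree it suffices to expand the six terms of
  a single directed 3-clique and extend by linearity.\<close>

lemma dFl_boundaries_1_subset_cycles: "dFl_boundaries 1 G \<subseteq> dFl_cycles 1 G"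
proof -
  have "dFl_boundary (dFl_boundary x) = 0" if "Poly_Mapping.keys x \<subseteq> directed_cliques 2 G" for x
    using that
  proof (induction x rule: frag_induction)
    case (one vs)
    then obtain a b c where "vs = [a, b, c]"
      by (auto simp: directed_cliques_def length_3_conv)
    then show ?case
      by (simp add: dFl_boundary_3 dFl_boundary_2 dFl_boundary_diff dFl_boundary_add)
  qed (simp_all add: dFl_boundary_diff)
  moreover have "Poly_Mapping.keys (dFl_boundary x) \<subseteq> directed_cliques 1 G"
    if "Poly_Mapping.keys x \<subseteq> directed_cliques 2 G" for x
    using keys_dFl_boundary[of x 1 G] that by simp
  ultimately show ?thesis
    by (simp add: dFl_boundaries_def dFl_def dFl_cycles_eq image_subset_iff)
qed

lemmas frag_quot_intros =
  subgroup_dFl_cycles[unfolded dFl_def] subgroup_dFl_boundaries[unfolded dFl_def]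
  dFl_boundaries_1_subset_cycles

lemma betti_1_eq_0:
  assumes "dFl_cycles 1 G \<subseteq> dFl_boundaries 1 G"
  shows "betti 1 G = 0"
  unfolding betti_def dFl_homology_def dFl_def
  by (rule abelian_rank_frag_quot_eq_0[OF frag_quot_intros assms])

lemma betti_1_le:
  assumes "finite (pverts G)"
  shows "betti 1 G \<le> card (directed_cliques 1 G)"
  unfolding betti_def dFl_homology_def dFl_def
  by (rule abelian_rank_frag_quot_le[OF frag_quot_intros finite_directed_cliques[OF assms]])

lemma indep_mod_frag_of: "finite I \<Longrightarrow> indep_mod {0} frag_of I"
proof (rule indep_modI)
  fix c :: "_ \<Rightarrow> int" and i
  assume I: "finite I" "i \<in> I" and c: "(\<Sum>i\<in>I. frag_cmul (c i) (frag_of i)) \<in> {0}"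
  have "Poly_Mapping.lookup (\<Sum>j\<in>I. frag_cmul (c j) (frag_of j)) i = (\<Sum>j\<in>I. if i = j then c j else 0)"
    by (auto simp: lookup_sum intro!: sum.cong)
  also have "\<dots> = c i" using I by simp
  finally show "c i = 0" using c by simp
qed

text \<open>The arcs form an independent family. Killing the coordinates of the boundary at all
  vertices turns it into a family of cycles, at a cost of one per vertex; passing to the quotient by
  boundaries then costs at most one per directed 3-clique.\<close>

lemma card_directed_cliques_1_le:
  assumes "finite (pverts G)"
  shows "card (directed_cliques 1 G) \<le> betti 1 G + card (directed_cliques 0 G) + card (directed_cliques 2 G)"
proof -
  note fin = finite_directed_cliques[OF assms]
  define f :: "'a list \<Rightarrow> 'a list \<Rightarrow>\<^sub>0 int" where
    "f = (\<lambda>vs. \<Sum>i<length vs. frag_cmul ((-1) ^ i) (frag_of (delete_vertex i vs)))"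
  have f: "dFl_boundary = frag_extend f" by (simp add: dFl_boundary_def f_def)
  have sub: "subgroup (carrier (free_Abelian_group (directed_cliques 1 G)))
      (free_Abelian_group (directed_cliques 1 G))"
    by (simp add: group.subgroup_self)
  have im: "frag_of ` directed_cliques 1 G \<subseteq> carrier (free_Abelian_group (directed_cliques 1 G))"
    by (auto simp: keys_frag_of)
  from indep_mod_kill_coordinates[OF fin[of 0] fin[of 1] indep_mod_frag_of[OF fin[of 1]] sub im, where f = f]
  obtain u and I :: "'a list set" where I: "finite I"
    "card (directed_cliques 1 G) \<le> card I + card (directed_cliques 0 G)"
    "indep_mod {0} u I" "u ` I \<subseteq> carrier (free_Abelian_group (directed_cliques 1 G))"
    "\<forall>i\<in>I. \<forall>a\<in>directed_cliques 0 G. Poly_Mapping.lookup (frag_extend f (u i)) a = 0"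
    by (elim exE conjE) (rule that)
  have uZ: "u i \<in> dFl_cycles 1 G" if "i \<in> I" for i
  proof -
    have k: "Poly_Mapping.keys (u i) \<subseteq> directed_cliques 1 G" using I(4) that by (simp add: image_subset_iff)
    then have "Poly_Mapping.keys (dFl_boundary (u i)) \<subseteq> directed_cliques 0 G"
      using keys_dFl_boundary[of "u i" 0 G] by simp
    moreover have "a \<notin> Poly_Mapping.keys (dFl_boundary (u i))" if "a \<in> directed_cliques 0 G" for a
      using I(5) that \<open>i \<in> I\<close> by (simp add: f in_keys_iff)
    ultimately have "Poly_Mapping.keys (dFl_boundary (u i)) = {}" by blast
    then show ?thesis using k by (simp add: dFl_cycles_eq)
  qed
  from indep_mod_relations[OF fin[of 2] I(1,3), where f = f]
  obtain J where J: "J \<subseteq> I" "card I \<le> card J + card (directed_cliques 2 G)"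
    "indep_mod (frag_extend f ` carrier (free_Abelian_group (directed_cliques 2 G))) u J"
    by (elim exE conjE) (rule that)
  have "card J \<le> betti 1 G"
    unfolding betti_def dFl_homology_def dFl_def
  proof (rule card_le_abelian_rank_frag_quot[OF frag_quot_intros fin])
    show "indep_mod (dFl_boundaries 1 G) u J"
      using J(3) by (simp add: dFl_boundaries_def dFl_def f)
    show "u ` J \<subseteq> dFl_cycles 1 G" using uZ J(1) by auto
    show "finite J" using J(1) I(1) by (rule finite_subset)
  qed
  then show ?thesis using I(2) J(2) by linarith
qed

section \<open>Vanishing of the first homology\<close>

lemma length_2_conv: "length xs = 2 \<longleftrightarrow> (\<exists>a b. xs = [a, b])"
  by (auto simp: numeral_2_eq_2 length_Suc_conv)

lemma directed_cliques_1_iff: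
  "vs \<in> directed_cliques 1 G \<longleftrightarrow>
     (\<exists>a b. vs = [a, b] \<and> a \<noteq> b \<and> a \<in> pverts G \<and> b \<in> pverts G \<and> (a, b) \<in> parcs G)"
  unfolding directed_cliques_altdef by (auto simp: length_2_conv)

lemma dFl_cycles_1_keysE:
  assumes "z \<in> dFl_cycles 1 G" "vs \<in> Poly_Mapping.keys z"
  obtains a b where "vs = [a, b]" "a \<noteq> b" "(a, b) \<in> parcs G"
proof -
  have "vs \<in> directed_cliques 1 G" using assms by (auto simp: dFl_cycles_eq)
  then show ?thesis using that by (auto simp: directed_cliques_1_iff)
qed

section \<open>Vanishing from common out-neighbours\<close>

lemma dFl_boundaries_triangle:
  assumes "distinct [a, b, c]" "{a, b, c} \<subseteq> pverts G"
    and "(a, b) \<in> parcs G" "(b, c) \<in> parcs G" "(a, c) \<in> parcs G"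
  shows "frag_of [b, c] - frag_of [a, c] + frag_of [a, b] \<in> dFl_boundaries 1 G"
  unfolding dFl_boundaries_def dFl_def
proof (rule image_eqI)
  show "frag_of [b, c] - frag_of [a, c] + frag_of [a, b] = dFl_boundary (frag_of [a, b, c])"
    by (simp add: dFl_boundary_3)
  show "frag_of [a, b, c] \<in> carrier (free_Abelian_group (directed_cliques (1 + 1) G))"
    using assms by (simp add: keys_frag_of directed_cliques_altdef)
qed

lemma dFl_cycles_1_subset_boundaries:
  assumes arcs: "\<And>a b. (a, b) \<in> parcs G \<Longrightarrow> a \<in> pverts G \<and> b \<in> pverts G \<and> a \<noteq> b"
    and common: "\<And>a b c d. {a, b, c, d} \<subseteq> pverts G \<Longrightarrow> \<exists>w. {(a, w), (b, w), (c, w), (d, w)} \<subseteq> parcs G"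
  shows "dFl_cycles 1 G \<subseteq> dFl_boundaries 1 G"
proof (cases "pverts G = {}")
  case True
  then have "directed_cliques 1 G = {}" by (auto simp: directed_cliques_1_iff)
  then have "dFl_cycles 1 G \<subseteq> {0}" by (auto simp: dFl_cycles_eq)
  then show ?thesis
    using subgroup_free_Abelian_groupD(1)[OF subgroup_dFl_boundaries[unfolded dFl_def]] by auto
next
  case False
  then obtain r where r: "r \<in> pverts G" by blast
  let ?B = "dFl_boundaries 1 G"
  note sub = subgroup_dFl_boundaries[of 1 G, unfolded dFl_def]
  note diff = subgroup_free_Abelian_groupD(2)[OF sub] and add = subgroup_free_Abelian_groupD(3)[OF sub]
  have tri: "frag_of [b, c] - frag_of [a, c] + frag_of [a, b] \<in> ?B"
    if "(a, b) \<in> parcs G" "(b, c) \<in> parcs G" "(a, c) \<in> parcs G" for a b c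
    using that arcs[OF that(1)] arcs[OF that(2)] arcs[OF that(3)] by (intro dFl_boundaries_triangle) auto
  define P where "P = (\<lambda>w a c. frag_of [a, w] - frag_of [c, w] :: 'a list \<Rightarrow>\<^sub>0 int)"
  have P_indep: "P w a c - P w' a c \<in> ?B"
    if "(a, w) \<in> parcs G" "(c, w) \<in> parcs G" "(a, w') \<in> parcs G" "(c, w') \<in> parcs G" for a c w w'
  proof -
    \<comment> \<open>Two common out-neighbours need not be adjacent, so both are compared with a
      vertex \<open>u\<close> dominated by all of \<open>a\<close>, \<open>c\<close>,
      \<open>w\<close>, \<open>w'\<close>. This is where four vertices enter.\<close>
    have "{a, c, w, w'} \<subseteq> pverts G" using that[THEN arcs] by auto
    then obtain u where u: "(a, u) \<in> parcs G" "(c, u) \<in> parcs G" "(w, u) \<in> parcs G" "(w', u) \<in> parcs G"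
      using common[of a c w w'] by auto
    have step: "P x a c - P u a c \<in> ?B"
      if "(a, x) \<in> parcs G" "(c, x) \<in> parcs G" "(x, u) \<in> parcs G" for x
      \<comment> \<open>The directed 3-cliques on \<open>a\<close>, \<open>x\<close>,
        \<open>u\<close> and on \<open>c\<close>, \<open>x\<close>, \<open>u\<close> share the arc
        from \<open>x\<close> to \<open>u\<close>, which cancels in the difference of their
        boundaries.\<close>
      using diff[OF tri[OF that(1,3) u(1)] tri[OF that(2,3) u(2)]]
      by (simp add: P_def algebra_simps)
    show ?thesis
      using diff[OF step[OF that(1,2) u(3)] step[OF that(3,4) u(4)]] by (simp add: algebra_simps)
  qed
  define w where "w = (\<lambda>a. SOME w. (a, w) \<in> parcs G \<and> (r, w) \<in> parcs G)"
  define f where "f = (\<lambda>a. P (w a) a r)"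
  have w: "(a, w a) \<in> parcs G" "(r, w a) \<in> parcs G" if "a \<in> pverts G" for a
    using someI_ex[of "\<lambda>w. (a, w) \<in> parcs G \<and> (r, w) \<in> parcs G"] common[of a r a r] that r
    by (auto simp: w_def)
  have edge: "frag_of [a, b] + (f b - f a) \<in> ?B" if ab: "(a, b) \<in> parcs G" for a b
  proof -
    have V: "a \<in> pverts G" "b \<in> pverts G" using arcs[OF ab] by auto
    \<comment> \<open>With one \<open>v\<close> for \<open>a\<close>, \<open>b\<close> and
      \<open>r\<close>, the boundary of the 3-clique on \<open>a\<close>, \<open>b\<close>,
      \<open>v\<close> is the arc plus \<open>P v b r - P v a r\<close>; independence of the choice
      of \<open>v\<close> replaces these two terms by \<open>f b\<close> and
      \<open>f a\<close>.\<close>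
    obtain v where v: "(a, v) \<in> parcs G" "(b, v) \<in> parcs G" "(r, v) \<in> parcs G"
      using common[of a b r r] V r by auto
    have "f a - P v a r \<in> ?B" "f b - P v b r \<in> ?B"
      using P_indep[OF w[OF V(1)] v(1,3)] P_indep[OF w[OF V(2)] v(2,3)] by (simp_all add: f_def)
    from add[OF diff[OF tri[OF ab v(2,1)] this(1)] this(2)] show ?thesis
      by (simp add: P_def algebra_simps)
  qed
  \<comment> \<open>The linear extension of \<open>f\<close> to 0-chains, whose generators are
    one-element lists, hence \<open>hd\<close>. It acts as a chain homotopy: the identity plus
    \<open>F\<close> after the boundary maps 1-chains into boundaries.\<close>
  define F where "F = frag_extend (\<lambda>vs. f (hd vs))"
  have main: "x + F (dFl_boundary x) \<in> ?B" if "Poly_Mapping.keys x \<subseteq> directed_cliques 1 G" for x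
    using that
  proof (induction x rule: frag_induction)
    case zero
    show ?case using subgroup_free_Abelian_groupD(1)[OF sub] by (simp add: F_def)
  next
    case (one vs)
    then obtain a b where "vs = [a, b]" "(a, b) \<in> parcs G" by (auto simp: directed_cliques_1_iff)
    then show ?case using edge[of a b] by (simp add: dFl_boundary_2 F_def frag_extend_diff)
  next
    case (diff x y)
    from subgroup_free_Abelian_groupD(2)[OF sub this] show ?case
      by (simp add: dFl_boundary_diff F_def frag_extend_diff algebra_simps)
  qed
  show ?thesis
  proof
    fix z assume "z \<in> dFl_cycles 1 G"
    then show "z \<in> ?B" using main[of z] by (simp add: dFl_cycles_eq F_def)
  qed
qed

text \<open>If \<open>[a, b]\<close> were the only arc of the support at \<open>v\<close>, the
  coefficient of \<open>[v]\<close> in the boundary would be plus or minus its nonzero coefficient.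
  Hence the support has no vertex of degree one.\<close>

lemma dFl_cycle_incident_arc:
  assumes z: "z \<in> dFl_cycles 1 G" and ab: "[a, b] \<in> Poly_Mapping.keys z" and v: "v = a \<or> v = b"
  shows "\<exists>c d. [c, d] \<in> Poly_Mapping.keys z \<and> (c, d) \<noteq> (a, b) \<and> (v = c \<or> v = d)"
proof (rule ccontr)
  assume H: "\<not> ?thesis"
  let ?g = "\<lambda>vs. Poly_Mapping.lookup z vs * Poly_Mapping.lookup (dFl_boundary (frag_of vs)) [v]"
  have "a \<noteq> b" using dFl_cycles_1_keysE[OF z ab] by auto
  have zero: "?g vs = 0" if vs: "vs \<in> Poly_Mapping.keys z - {[a, b]}" for vs
  proof -
    obtain c d where cd: "vs = [c, d]" using vs by (auto elim: dFl_cycles_1_keysE[OF z])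
    then have "v \<noteq> c" "v \<noteq> d" using H vs by auto
    then show ?thesis by (simp add: cd dFl_boundary_2 lookup_minus)
  qed
  have "Poly_Mapping.lookup (dFl_boundary z) [v] = (\<Sum>vs\<in>Poly_Mapping.keys z. ?g vs)"
    by (simp add: dFl_boundary_def frag_extend_def[of _ z] lookup_sum)
  also have "\<dots> = (\<Sum>vs\<in>{[a, b]}. ?g vs)"
    using ab zero by (intro sum.mono_neutral_right) auto
  also have "\<dots> = Poly_Mapping.lookup z [a, b] * (if v = b then 1 else - 1)"
    using v \<open>a \<noteq> b\<close> by (auto simp: dFl_boundary_2 lookup_minus)
  finally have "Poly_Mapping.lookup (dFl_boundary z) [v] \<noteq> 0" using ab by (auto simp: in_keys_iff)
  then show False using z by (simp add: dFl_cycles_eq)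
qed

section \<open>Cycles in the underlying undirected multigraph\<close>

definition joins :: "'a \<times> 'a \<Rightarrow> 'a \<Rightarrow> 'a \<Rightarrow> bool" where
  "joins e v w \<longleftrightarrow> e = (v, w) \<or> e = (w, v)"

text \<open>A closed walk is given by its vertices together with the orientation of the arc leaving each of them.\<close>

definition walk_arc :: "('a \<times> bool) list \<Rightarrow> nat \<Rightarrow> 'a \<times> 'a" where
  "walk_arc xs i =
     (let v = fst (xs ! i); w = fst (xs ! (Suc i mod length xs)) in if snd (xs ! i) then (v, w) else (w, v))"

definition walk_arcs :: "('a \<times> bool) list \<Rightarrow> ('a \<times> 'a) set" where
  "walk_arcs xs = walk_arc xs ` {..<length xs}"

text \<open>Length two is allowed, for a pair of opposite arcs. The cardinality condition excludes
  going back and forth along one arc, and it supplies the exponent in the later union bound.\<close>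

definition oriented_cycle :: "('a \<times> bool) list \<Rightarrow> bool" where
  "oriented_cycle xs \<longleftrightarrow>
     2 \<le> length xs \<and> distinct (map fst xs) \<and> card (walk_arcs xs) = length xs"

lemma mod_Suc_swap:
  fixes i j k :: nat
  assumes "i < k" "j < k" "i \<noteq> j" and i: "i = Suc j mod k" and j: "j = Suc i mod k"
  shows "k = 2"
proof -
  have "Suc l = k \<and> Suc l mod k = 0 \<or> Suc l mod k = Suc l" if "l < k" for l
    using that by (cases "Suc l = k") simp_all
  from this[OF assms(1)] this[OF assms(2)] show ?thesis
    using assms(3) unfolding i[symmetric] j[symmetric] by arith
qed

text \<open>If the arcs at two positions coincide, their endpoints do, so each position is the
  cyclic successor of the other. By \<open>mod_Suc_swap\<close> this occurs only in length two, the
  case covered by the last hypothesis.\<close>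

lemma ex_oriented_cycleI:
  assumes vs: "distinct vs" "2 \<le> length vs"
    and e: "\<And>i. i < length vs \<Longrightarrow> e i \<in> A \<and> joins (e i) (vs ! i) (vs ! (Suc i mod length vs))"
    and e01: "length vs = 2 \<Longrightarrow> e 0 \<noteq> e 1"
  shows "\<exists>xs. oriented_cycle xs \<and> walk_arcs xs \<subseteq> A \<and> map fst xs = vs"
proof -
  let ?k = "length vs"
  define xs where "xs = map (\<lambda>i. (vs ! i, e i = (vs ! i, vs ! (Suc i mod ?k)))) [0..<?k]"
  have len: "length xs = ?k" by (simp add: xs_def)
  have fst: "map fst xs = vs" by (simp add: xs_def comp_def map_nth)
  have nth: "xs ! i = (vs ! i, e i = (vs ! i, vs ! (Suc i mod ?k)))" if "i < ?k" for i
    using that by (simp add: xs_def)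
  have m: "Suc i mod ?k < ?k" for i using vs(2) by (intro mod_less_divisor) linarith
  have arc: "walk_arc xs i = e i" if "i < ?k" for i
    using e[OF that] nth[OF that] nth[OF m[of i]] by (auto simp: walk_arc_def len joins_def Let_def)
  have "inj_on e {..<?k}"
  proof (rule inj_onI, rule ccontr)
    fix i j assume ij: "i \<in> {..<?k}" "j \<in> {..<?k}" "e i = e j" "i \<noteq> j"
    have "{vs ! i, vs ! (Suc i mod ?k)} = {vs ! j, vs ! (Suc j mod ?k)}"
      using e[of i] e[of j] ij unfolding joins_def by auto
    then have "i = Suc j mod ?k" "j = Suc i mod ?k"
      using ij vs(1) m[of i] m[of j] by (auto simp: doubleton_eq_iff nth_eq_iff_index_eq)
    from mod_Suc_swap[OF _ _ ij(4) this] ij(1,2) have "?k = 2" by simp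
    then have "i = 0 \<and> j = 1 \<or> i = 1 \<and> j = 0" using ij(1,2,4) unfolding lessThan_iff by linarith
    then show False using e01[OF \<open>?k = 2\<close>] ij(3) by metis
  qed
  moreover have "walk_arcs xs = e ` {..<?k}" using arc by (auto simp: walk_arcs_def len)
  ultimately have "card (walk_arcs xs) = length xs" by (simp add: card_image len)
  moreover have "walk_arcs xs \<subseteq> A" using arc e by (simp add: walk_arcs_def len image_subset_iff)
  ultimately show ?thesis
    using vs fst len by (intro exI[of _ xs]) (simp add: oriented_cycle_def)
qed

text \<open>The longest-path argument for minimum degree two, in a multigraph where opposite arcs
  are different edges.\<close>

lemma ex_oriented_cycle:
  assumes fin: "finite A" and ne: "A \<noteq> {}" and noloop: "\<And>v. (v, v) \<notin> A"
    and deg: "\<And>e v w. e \<in> A \<Longrightarrow> joins e v w \<Longrightarrow> \<exists>e'\<in>A. \<exists>w'. e' \<noteq> e \<and> joins e' v w'"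
  shows "\<exists>xs. oriented_cycle xs \<and> walk_arcs xs \<subseteq> A"
proof -
  define V where "V = fst ` A \<union> snd ` A"
  have finV: "finite V" using fin by (simp add: V_def)
  have inV: "v \<in> V" "w \<in> V" if "e \<in> A" "joins e v w" for e v w
    using that by (force simp: V_def joins_def)+
  \<comment> \<open>The arc \<open>e\<close> between the first two vertices is kept as data: there
    may be two such arcs, and the extra arc at the first vertex must differ from the one already
    used.\<close>
  define path where "path = (\<lambda>(vs, e). 2 \<le> length vs \<and> distinct vs \<and> set vs \<subseteq> V \<and>
     e \<in> A \<and> joins e (vs ! 0) (vs ! 1) \<and>
     (\<forall>i. Suc i < length vs \<longrightarrow> (\<exists>e\<in>A. joins e (vs ! i) (vs ! Suc i))))"
  obtain a b where ab: "(a, b) \<in> A" using ne by auto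
  then have "path ([a, b], (a, b))"
    using noloop[of a] inV[of "(a, b)" a b] by (auto simp: path_def joins_def less_Suc_eq)
  moreover have "\<forall>p. path p \<longrightarrow> length (fst p) < Suc (card V)"
    using finV by (auto simp: path_def less_Suc_eq_le intro: card_mono simp flip: distinct_card)
  ultimately have "\<exists>p. path p \<and> (\<forall>q. path q \<longrightarrow> length (fst q) \<le> length (fst p))"
    by (rule ex_has_greatest_nat)
  then obtain p where p: "path p" "\<And>q. path q \<Longrightarrow> length (fst q) \<le> length (fst p)"
    by blast
  \<comment> \<open>A further arc at the first vertex of a longest path leads back to the path.\<close>
  obtain vs e where pe: "p = (vs, e)" by (cases p)
  have vs: "2 \<le> length vs" "distinct vs" "set vs \<subseteq> V" "e \<in> A" "joins e (vs ! 0) (vs ! 1)"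
    "\<And>i. Suc i < length vs \<Longrightarrow> \<exists>e\<in>A. joins e (vs ! i) (vs ! Suc i)"
    using p(1) by (auto simp: path_def pe)
  obtain e' w where e': "e' \<in> A" "e' \<noteq> e" "joins e' (vs ! 0) w"
    using deg[OF vs(4,5)] by blast
  have "w \<in> set vs"
  proof (rule ccontr)
    assume w: "w \<notin> set vs"
    have "path (w # vs, e')"
      unfolding path_def prod.case
    proof (intro conjI allI impI)
      show "2 \<le> length (w # vs)" "distinct (w # vs)" "set (w # vs) \<subseteq> V" "e' \<in> A"
        "joins e' ((w # vs) ! 0) ((w # vs) ! 1)"
        using vs w e' inV[OF e'(1,3)] by (auto simp: joins_def)
      fix i assume i: "Suc i < length (w # vs)"
      show "\<exists>e\<in>A. joins e ((w # vs) ! i) ((w # vs) ! Suc i)"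
      proof (cases i)
        case 0
        then show ?thesis using e' by (auto simp: joins_def)
      next
        case (Suc j)
        then show ?thesis using vs(6)[of j] i by auto
      qed
    qed
    from p(2)[OF this] show False by (simp add: pe)
  qed
  then obtain j where j: "j < length vs" "w = vs ! j" by (metis in_set_conv_nth)
  have "j \<noteq> 0"
  proof
    assume "j = 0"
    then show False using e'(1,3) j(2) noloop by (auto simp: joins_def)
  qed
  define us where "us = take (Suc j) vs"
  have len: "length us = Suc j" using j by (simp add: us_def)
  \<comment> \<open>The first edge is \<open>e\<close>, the closing edge is \<open>e'\<close>, and
    any joining arc serves in between. If \<open>j = 1\<close>, the cycle consists of the two
    opposite arcs \<open>e\<close> and \<open>e'\<close>.\<close>
  define d where "d = (\<lambda>i. if i = 0 then e else if i = j then e'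
     else SOME e. e \<in> A \<and> joins e (vs ! i) (vs ! Suc i))"
  have "\<exists>xs. oriented_cycle xs \<and> walk_arcs xs \<subseteq> A \<and> map fst xs = us"
  proof (rule ex_oriented_cycleI)
    show "distinct us" using vs(2) by (simp add: us_def)
    show "2 \<le> length us" using len \<open>j \<noteq> 0\<close> by simp
    show "d 0 \<noteq> d 1" if "length us = 2" using that len e'(2) by (simp add: d_def)
    fix i assume i: "i < length us"
    consider "i = 0" | "i = j" "i \<noteq> 0" | "i < j" "i \<noteq> 0" using i len by linarith
    then show "d i \<in> A \<and> joins (d i) (us ! i) (us ! (Suc i mod length us))"
    proof cases
      case 1
      then show ?thesis using vs(4,5) \<open>j \<noteq> 0\<close> len by (simp add: d_def us_def)
    next
      case 2
      then show ?thesis using e' j by (auto simp: d_def us_def len joins_def)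
    next
      case 3
      then have "\<exists>e. e \<in> A \<and> joins e (vs ! i) (vs ! Suc i)" using vs(6)[of i] j by auto
      from someI_ex[OF this] show ?thesis using 3 len by (simp add: d_def us_def)
    qed
  qed
  then show ?thesis by blast
qed

lemma betti_1_eq_0_if_no_oriented_cycle:
  assumes "\<And>xs. oriented_cycle xs \<Longrightarrow> \<not> walk_arcs xs \<subseteq> parcs G"
  shows "betti 1 G = 0"
proof (rule betti_1_eq_0)
  have "z = 0" if z: "z \<in> dFl_cycles 1 G" for z
  proof (rule ccontr)
    assume "z \<noteq> 0"
    define A where "A = {(a, b). [a, b] \<in> Poly_Mapping.keys z}"
    have A: "a \<noteq> b \<and> (a, b) \<in> parcs G" if "(a, b) \<in> A" for a b
      using that dFl_cycles_1_keysE[OF z, of "[a, b]"] by (auto simp: A_def)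
    have "\<exists>xs. oriented_cycle xs \<and> walk_arcs xs \<subseteq> A"
    proof (rule ex_oriented_cycle)
      have "A \<subseteq> (\<lambda>vs. (vs ! 0, vs ! 1)) ` Poly_Mapping.keys z" by (force simp: A_def)
      then show "finite A" by (rule finite_subset) simp
      have "Poly_Mapping.keys z \<noteq> {}" using \<open>z \<noteq> 0\<close> by simp
      then obtain vs where "vs \<in> Poly_Mapping.keys z" by blast
      moreover from this obtain a b where "vs = [a, b]" by (rule dFl_cycles_1_keysE[OF z])
      ultimately have "(a, b) \<in> A" by (simp add: A_def)
      then show "A \<noteq> {}" by blast
      show "(v, v) \<notin> A" for v using A by blast
      fix e v w assume e: "e \<in> A" "joins e v w"
      then have "[fst e, snd e] \<in> Poly_Mapping.keys z" "v = fst e \<or> v = snd e"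
        by (auto simp: A_def joins_def)
      from dFl_cycle_incident_arc[OF z this] obtain c d where
        "(c, d) \<in> A" "(c, d) \<noteq> e" "v = c \<or> v = d" by (auto simp: A_def)
      then show "\<exists>e'\<in>A. \<exists>w'. e' \<noteq> e \<and> joins e' v w'" by (auto simp: joins_def)
    qed
    moreover have "A \<subseteq> parcs G" using A by auto
    ultimately show False using assms by blast
  qed
  then show "dFl_cycles 1 G \<subseteq> dFl_boundaries 1 G"
    using subgroup_free_Abelian_groupD(1)[OF subgroup_dFl_boundaries[unfolded dFl_def]] by blast
qed

section \<open>Random digraphs\<close>

definition all_arcs :: "nat \<Rightarrow> (nat \<times> nat) set" where
  "all_arcs n = {(i, j). i \<in> {1..n} \<and> j \<in> {1..n} \<and> i \<noteq> j}"

lemma finite_all_arcs [simp]: "finite (all_arcs n)"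
  by (rule finite_subset[of _ "{1..n} \<times> {1..n}"]) (auto simp: all_arcs_def)

lemma card_all_arcs: "real (card (all_arcs n)) = real n * (real n - 1)"
proof -
  have "all_arcs n = {1..n} \<times> {1..n} - (\<lambda>i. (i, i)) ` {1..n}"
    by (auto simp: all_arcs_def)
  also have "card \<dots> = card ({1..n} \<times> {1..n}) - card ((\<lambda>i. (i, i)) ` {1..n})"
    by (intro card_Diff_subset) auto
  also have "\<dots> = n * n - n"
    by (subst card_image) (auto simp: inj_on_def)
  finally show ?thesis by (simp add: of_nat_diff algebra_simps)
qed

lemma set_random_digraph:
  assumes "G \<in> set_pmf (random_digraph n p)"
  shows "pverts G = {1..n}" "parcs G \<subseteq> all_arcs n"
proof -
  obtain f where f: "f \<in> set_pmf (Pi_pmf (all_arcs n) False (\<lambda>_. bernoulli_pmf p))"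
    "G = \<lparr>pverts = {1..n}, parcs = {e. f e}\<rparr>"
    using assms by (auto simp: random_digraph_def all_arcs_def)
  show "pverts G = {1..n}" by (simp add: f(2))
  have "f e = False" if "e \<notin> all_arcs n" for e
    using set_Pi_pmf_subset[of "all_arcs n" False "\<lambda>_. bernoulli_pmf p"] f(1) that
    by (auto simp del: split_paired_All)
  then show "parcs G \<subseteq> all_arcs n" by (auto simp: f(2))
qed

lemma finite_set_random_digraph: "finite (set_pmf (random_digraph n p))"
proof (rule finite_subset)
  show "set_pmf (random_digraph n p) \<subseteq>
      (\<lambda>A. \<lparr>pverts = {1..n}, parcs = A\<rparr>) ` Pow (all_arcs n)"
  proof
    fix G assume "G \<in> set_pmf (random_digraph n p)"
    from set_random_digraph[OF this] show "G \<in> (\<lambda>A. \<lparr>pverts = {1..n}, parcs = A\<rparr>) ` Pow (all_arcs n)"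
      by (intro image_eqI[of _ _ "parcs G"]) (auto intro: pair_pre_digraph.equality)
  qed
qed simp

text \<open>Finite support discharges every integrability condition on expectations below.\<close>

lemma integrable_random_digraph [simp]:
  "integrable (measure_pmf (random_digraph n p)) (f :: _ \<Rightarrow> real)"
  by (rule integrable_measure_pmf_finite[OF finite_set_random_digraph])

text \<open>The event is a product set, with \<open>True\<close> prescribed on \<open>F\<close> and
  no constraint elsewhere, so the product measure factorises.\<close>

lemma prob_arcs_present:
  assumes p: "0 \<le> p" "p \<le> 1" and F: "F \<subseteq> all_arcs n"
  shows "measure_pmf.prob (random_digraph n p) {G. F \<subseteq> parcs G} = p ^ card F"
proof -
  let ?P = "Pi_pmf (all_arcs n) False (\<lambda>_. bernoulli_pmf p)"
  let ?B = "\<lambda>e. if e \<in> F then {True} else UNIV"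
  have "measure_pmf.prob (random_digraph n p) {G. F \<subseteq> parcs G} = measure_pmf.prob ?P (Pi (all_arcs n) ?B)"
    using F unfolding random_digraph_def all_arcs_def[symmetric] measure_map_pmf
    by (intro arg_cong[where f = "measure_pmf.prob _"]) (auto simp: Pi_def)
  also have "\<dots> = (\<Prod>e\<in>all_arcs n. measure_pmf.prob (bernoulli_pmf p) (?B e))"
    by (rule measure_Pi_pmf_Pi) simp
  also have "\<dots> = (\<Prod>e\<in>all_arcs n. if e \<in> F then p else 1)"
    using p by (intro prod.cong refl) (auto simp: measure_pmf_single)
  also have "\<dots> = p ^ card F"
    using F by (simp add: prod.If_cases Int_absorb1)
  finally show ?thesis .
qed

text \<open>A set containing an inadmissible arc is never present. This lets union bounds run over
  lists without checking that their arcs are admissible.\<close>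

lemma prob_arcs_present_le:
  assumes p: "0 \<le> p" "p \<le> 1"
  shows "measure_pmf.prob (random_digraph n p) {G. F \<subseteq> parcs G} \<le> p ^ card F"
proof (cases "F \<subseteq> all_arcs n")
  case True
  then show ?thesis using prob_arcs_present[OF p] by simp
next
  case False
  have "measure_pmf.prob (random_digraph n p) {G. F \<subseteq> parcs G} = 0"
    unfolding measure_pmf_zero_iff using set_random_digraph(2) False by blast
  then show ?thesis using p by simp
qed

lemma expectation_arcs_present:
  assumes "0 \<le> p" "p \<le> 1" "F \<subseteq> all_arcs n"
  shows "measure_pmf.expectation (random_digraph n p) (\<lambda>G. of_bool (F \<subseteq> parcs G)) = p ^ card F"
proof -
  have "(\<lambda>G :: nat pair_pre_digraph. of_bool (F \<subseteq> parcs G)) = indicat_real {G. F \<subseteq> parcs G}"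
    by (auto simp: indicator_def)
  then show ?thesis unfolding prob_arcs_present[OF assms, symmetric] by simp
qed

lemma expectation_mono_random_digraph:
  assumes "\<And>G. G \<in> set_pmf (random_digraph n p) \<Longrightarrow> f G \<le> (g G :: real)"
  shows "measure_pmf.expectation (random_digraph n p) f \<le> measure_pmf.expectation (random_digraph n p) g"
  by (rule integral_mono_AE) (auto simp: AE_measure_pmf_iff assms)

lemma expectation_cong_random_digraph:
  assumes "\<And>G. G \<in> set_pmf (random_digraph n p) \<Longrightarrow> f G = (g G :: real)"
  shows "measure_pmf.expectation (random_digraph n p) f = measure_pmf.expectation (random_digraph n p) g"
  by (rule integral_cong_AE) (auto simp: AE_measure_pmf_iff assms)

section \<open>Moments of the number of arcs and expected number of 3-cliques\<close>

lemma card_parcs_eq_sum: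
  assumes "G \<in> set_pmf (random_digraph n p)"
  shows "real (card (parcs G)) = (\<Sum>e\<in>all_arcs n. of_bool ({e} \<subseteq> parcs G))"
  using set_random_digraph(2)[OF assms]
  by (simp add: sum.If_cases of_bool_def Int_absorb1 Collect_mem_eq Int_def[symmetric] cong: if_cong)

lemma expectation_card_parcs:
  assumes "0 \<le> p" "p \<le> 1"
  shows "measure_pmf.expectation (random_digraph n p) (\<lambda>G. real (card (parcs G))) = real n * (real n - 1) * p"
proof -
  have "measure_pmf.expectation (random_digraph n p) (\<lambda>G. real (card (parcs G))) =
        measure_pmf.expectation (random_digraph n p) (\<lambda>G. \<Sum>e\<in>all_arcs n. of_bool ({e} \<subseteq> parcs G))"
    by (rule expectation_cong_random_digraph) (rule card_parcs_eq_sum)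
  also have "\<dots> = (\<Sum>e\<in>all_arcs n. p ^ card {e})"
    by (subst Bochner_Integration.integral_sum, simp)
       (intro sum.cong refl expectation_arcs_present[OF assms], simp)
  finally show ?thesis by (simp add: card_all_arcs)
qed

text \<open>A binomial variable has variance at most its mean. In the double sum over pairs of arcs,
  only the diagonal contributes \<open>p\<close> instead of the square of \<open>p\<close>.\<close>

lemma expectation_card_parcs_deviation:
  fixes n :: nat
  assumes p: "0 \<le> p" "p \<le> 1"
  defines "\<mu> \<equiv> real n * (real n - 1) * p"
  shows "measure_pmf.expectation (random_digraph n p) (\<lambda>G. (real (card (parcs G)) - \<mu>)\<^sup>2) \<le> \<mu>"
proof -
  let ?E = "measure_pmf.expectation (random_digraph n p)"
  let ?m = "real n * (real n - 1)"
  have "?E (\<lambda>G. (real (card (parcs G)))\<^sup>2) =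
        ?E (\<lambda>G. \<Sum>e\<in>all_arcs n. \<Sum>e'\<in>all_arcs n. of_bool ({e, e'} \<subseteq> parcs G))"
  proof (rule expectation_cong_random_digraph)
    fix G assume G: "G \<in> set_pmf (random_digraph n p)"
    show "(real (card (parcs G)))\<^sup>2 = (\<Sum>e\<in>all_arcs n. \<Sum>e'\<in>all_arcs n. of_bool ({e, e'} \<subseteq> parcs G))"
      unfolding card_parcs_eq_sum[OF G] power2_eq_square sum_product by (intro sum.cong refl) auto
  qed
  also have "\<dots> = (\<Sum>e\<in>all_arcs n. \<Sum>e'\<in>all_arcs n. p ^ card {e, e'})"
    by (subst Bochner_Integration.integral_sum, simp, intro sum.cong refl,
        subst Bochner_Integration.integral_sum, simp,
        intro sum.cong refl expectation_arcs_present[OF p], simp)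
  also have "\<dots> \<le> (\<Sum>e\<in>all_arcs n. \<Sum>e'\<in>all_arcs n. p\<^sup>2 + (if e = e' then p else 0))"
    using p by (intro sum_mono) (auto simp: power2_eq_square)
  also have "\<dots> = ?m * (?m * p\<^sup>2 + p)"
    by (simp add: sum.distrib card_all_arcs algebra_simps)
  also have "\<dots> = \<mu>\<^sup>2 + \<mu>" by (simp add: \<mu>_def power2_eq_square algebra_simps)
  finally have sq: "?E (\<lambda>G. (real (card (parcs G)))\<^sup>2) \<le> \<mu>\<^sup>2 + \<mu>" .
  have "?E (\<lambda>G. (real (card (parcs G)) - \<mu>)\<^sup>2) =
        ?E (\<lambda>G. (real (card (parcs G)))\<^sup>2 - 2 * \<mu> * real (card (parcs G)) + \<mu>\<^sup>2)"
    by (intro Bochner_Integration.integral_cong) (auto simp: power2_eq_square algebra_simps)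
  also have "\<dots> = ?E (\<lambda>G. (real (card (parcs G)))\<^sup>2) - 2 * \<mu> * ?E (\<lambda>G. real (card (parcs G))) + \<mu>\<^sup>2"
    by (simp add: Bochner_Integration.integral_add Bochner_Integration.integral_diff)
  also have "\<dots> \<le> \<mu>"
    using sq unfolding expectation_card_parcs[OF p, of n, folded \<mu>_def] by (simp add: power2_eq_square)
  finally show ?thesis .
qed

lemma card_directed_cliques_0: "card (directed_cliques 0 G) = card (pverts G)"
proof -
  have "directed_cliques 0 G = (\<lambda>v. [v]) ` pverts G"
    by (auto simp: directed_cliques_altdef length_Suc_conv)
  then show ?thesis by (simp add: card_image inj_on_def)
qed

lemma card_directed_cliques_1:
  assumes "G \<in> set_pmf (random_digraph n p)"
  shows "card (directed_cliques 1 G) = card (parcs G)"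
proof -
  have "directed_cliques 1 G = (\<lambda>(a, b). [a, b]) ` parcs G"
    using set_random_digraph[OF assms] by (auto simp: directed_cliques_1_iff all_arcs_def)
  then show ?thesis by (simp add: card_image inj_on_def split: prod.splits)
qed

lemma expectation_card_directed_cliques_2:
  assumes p: "0 \<le> p" "p \<le> 1"
  shows "measure_pmf.expectation (random_digraph n p) (\<lambda>G. real (card (directed_cliques 2 G))) \<le> real n ^ 3 * p ^ 3"
proof -
  let ?L = "{vs. set vs \<subseteq> {1..n} \<and> length vs = 3}"
  have fin: "finite ?L" by (rule finite_lists_length_eq) simp
  have "measure_pmf.expectation (random_digraph n p) (\<lambda>G. real (card (directed_cliques 2 G))) \<le>
        measure_pmf.expectation (random_digraph n p) (\<lambda>G. \<Sum>vs\<in>?L. of_bool (vs \<in> directed_cliques 2 G))"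
  proof (rule expectation_mono_random_digraph)
    fix G assume G: "G \<in> set_pmf (random_digraph n p)"
    have "directed_cliques 2 G \<subseteq> ?L"
      using set_random_digraph(1)[OF G] by (auto simp: directed_cliques_def)
    then have "card (directed_cliques 2 G) = card {vs \<in> ?L. vs \<in> directed_cliques 2 G}"
      by (intro arg_cong[where f = card]) blast
    also have "real \<dots> = (\<Sum>vs\<in>?L. of_bool (vs \<in> directed_cliques 2 G))"
      using fin by (simp add: of_bool_def sum.If_cases Int_def)
    finally show "real (card (directed_cliques 2 G)) \<le> (\<Sum>vs\<in>?L. of_bool (vs \<in> directed_cliques 2 G))" by simp
  qed
  also have "\<dots> = (\<Sum>vs\<in>?L. measure_pmf.expectation (random_digraph n p) (\<lambda>G. of_bool (vs \<in> directed_cliques 2 G)))"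
    by (subst Bochner_Integration.integral_sum) simp_all
  also have "\<dots> \<le> (\<Sum>vs\<in>?L. p ^ 3)"
  proof (rule sum_mono)
    fix vs :: "nat list" assume "vs \<in> ?L"
    then obtain a b c where vs: "vs = [a, b, c]" by (auto simp: length_3_conv)
    let ?F = "{(a, b), (a, c), (b, c)}"
    show "measure_pmf.expectation (random_digraph n p) (\<lambda>G. of_bool (vs \<in> directed_cliques 2 G)) \<le> p ^ 3"
    proof (cases "distinct vs")
      case True
      then have card: "card ?F = 3" by (auto simp: vs)
      have "measure_pmf.expectation (random_digraph n p) (\<lambda>G. of_bool (vs \<in> directed_cliques 2 G)) \<le>
            measure_pmf.expectation (random_digraph n p) (indicat_real {G. ?F \<subseteq> parcs G})"
        by (intro expectation_mono_random_digraph) (auto simp: directed_cliques_altdef vs)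
      also have "\<dots> = measure_pmf.prob (random_digraph n p) {G. ?F \<subseteq> parcs G}" by simp
      also have "\<dots> \<le> p ^ card ?F" by (rule prob_arcs_present_le[OF p])
      finally show ?thesis using card by simp
    next
      case False
      then show ?thesis using p by (simp add: directed_cliques_def)
    qed
  qed
  also have "\<dots> = real n ^ 3 * p ^ 3"
    using card_lists_length_eq[of "{1..n}" 3] by simp
  finally show ?thesis .
qed

section \<open>Probability bounds for the first Betti number\<close>

lemma betti_1_bounds:
  assumes G: "G \<in> set_pmf (random_digraph n p)"
  shows "betti 1 G \<le> card (parcs G)" "card (parcs G) \<le> betti 1 G + n + card (directed_cliques 2 G)"
  using betti_1_le[of G] card_directed_cliques_1_le[of G] set_random_digraph(1)[OF G]
  by (simp_all add: card_directed_cliques_1[OF G] card_directed_cliques_0)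

lemma expectation_betti_1_le:
  assumes p: "0 \<le> p" "p \<le> 1"
  shows "measure_pmf.expectation (random_digraph n p) (\<lambda>G. real (betti 1 G)) \<le> real n * (real n - 1) * p"
  unfolding expectation_card_parcs[OF p, symmetric]
  by (rule expectation_mono_random_digraph) (use betti_1_bounds(1) in auto)

lemma expectation_betti_1_ge:
  assumes p: "0 \<le> p" "p \<le> 1"
  shows "real n * (real n - 1) * p - real n - real n ^ 3 * p ^ 3 \<le>
         measure_pmf.expectation (random_digraph n p) (\<lambda>G. real (betti 1 G))"
proof -
  have "real n * (real n - 1) * p \<le>
      measure_pmf.expectation (random_digraph n p)
        (\<lambda>G. real (betti 1 G) + real n + real (card (directed_cliques 2 G)))"
    unfolding expectation_card_parcs[OF p, symmetric]
  proof (rule expectation_mono_random_digraph)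
    fix G assume "G \<in> set_pmf (random_digraph n p)"
    from betti_1_bounds(2)[OF this]
    show "real (card (parcs G)) \<le> real (betti 1 G) + real n + real (card (directed_cliques 2 G))"
      unfolding of_nat_add[symmetric] of_nat_le_iff .
  qed
  also have "\<dots> = measure_pmf.expectation (random_digraph n p) (\<lambda>G. real (betti 1 G)) + real n +
      measure_pmf.expectation (random_digraph n p) (\<lambda>G. real (card (directed_cliques 2 G)))"
    by (simp add: Bochner_Integration.integral_add)
  finally show ?thesis using expectation_card_directed_cliques_2[OF p, of n] by linarith
qed

text \<open>If the Betti number vanishes, the arcs number at most \<open>n\<close> plus the
  3-cliques. As \<open>n\<close> is at most a quarter of the mean, either the 3-cliques reach a
  quarter of it (event \<open>?B\<close>, Markov) or the arcs fall short by at least half of it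
  (event \<open>?A\<close>, Chebyshev).\<close>

lemma prob_betti_1_eq_0_le:
  fixes n :: nat
  assumes p: "0 \<le> p" "p \<le> 1"
  defines "\<mu> \<equiv> real n * (real n - 1) * p"
  assumes \<mu>: "0 < \<mu>" "4 * real n \<le> \<mu>"
  shows "measure_pmf.prob (random_digraph n p) {G. betti 1 G = 0} \<le> 4 / \<mu> + 4 * (real n ^ 3 * p ^ 3) / \<mu>"
proof -
  let ?P = "measure_pmf.prob (random_digraph n p)" and ?E = "measure_pmf.expectation (random_digraph n p)"
  let ?A = "{G. (\<mu> / 2)\<^sup>2 \<le> (real (card (parcs G)) - \<mu>)\<^sup>2}"
  let ?B = "{G. \<mu> / 4 \<le> real (card (directed_cliques 2 G))}"
  have "?P {G. betti 1 G = 0} \<le> ?P (?A \<union> ?B)"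
  proof (rule measure_pmf.finite_measure_mono_AE)
    show "AE G in random_digraph n p. G \<in> {G. betti 1 G = 0} \<longrightarrow> G \<in> ?A \<union> ?B"
      unfolding AE_measure_pmf_iff
    proof (intro ballI impI)
      fix G assume G: "G \<in> set_pmf (random_digraph n p)" and "G \<in> {G. betti 1 G = 0}"
      then have "card (parcs G) \<le> n + card (directed_cliques 2 G)"
        using betti_1_bounds(2)[OF G] by simp
      then have le: "real (card (parcs G)) \<le> real n + real (card (directed_cliques 2 G))"
        unfolding of_nat_add[symmetric] of_nat_le_iff .
      show "G \<in> ?A \<union> ?B"
      proof (cases "G \<in> ?B")
        case False
        then have "\<mu> / 2 \<le> \<mu> - real (card (parcs G))" using le \<mu>(2) by simp
        then have "(\<mu> / 2)\<^sup>2 \<le> (\<mu> - real (card (parcs G)))\<^sup>2" using \<mu>(1) by (intro power_mono) auto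
        then show ?thesis by (simp add: power2_commute)
      qed simp
    qed
  qed simp
  also have "\<dots> \<le> ?P ?A + ?P ?B" by (rule measure_Un_le) simp_all
  also have "?P ?A \<le> ?E (\<lambda>G. (real (card (parcs G)) - \<mu>)\<^sup>2) / (\<mu> / 2)\<^sup>2"
    using integral_Markov_inequality_measure[of "measure_pmf (random_digraph n p)"
        "\<lambda>G. (real (card (parcs G)) - \<mu>)\<^sup>2" "{}" "(\<mu> / 2)\<^sup>2"] \<mu>(1) by simp
  also have "\<dots> \<le> \<mu> / (\<mu> / 2)\<^sup>2"
    using expectation_card_parcs_deviation[OF p, of n] by (intro divide_right_mono) (simp_all add: \<mu>_def)
  also have "\<dots> = 4 / \<mu>" using \<mu>(1) by (simp add: power2_eq_square field_simps)
  also have "?P ?B \<le> ?E (\<lambda>G. real (card (directed_cliques 2 G))) / (\<mu> / 4)"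
    using integral_Markov_inequality_measure[of "measure_pmf (random_digraph n p)"
        "\<lambda>G. real (card (directed_cliques 2 G))" "{}" "\<mu> / 4"] \<mu>(1) by simp
  also have "\<dots> \<le> (real n ^ 3 * p ^ 3) / (\<mu> / 4)"
    using expectation_card_directed_cliques_2[OF p, of n] \<mu>(1) by (intro divide_right_mono) simp_all
  finally show ?thesis by (simp add: mult.commute)
qed

text \<open>There are \<open>(2 * n) ^ k\<close> lists of \<open>k\<close> vertices with
  orientations, and the arcs of an oriented cycle among them are present with probability at most
  \<open>p ^ k\<close>. The bound 1/2 on the ratio makes the geometric series at most twice its
  first term.\<close>

lemma prob_betti_1_neq_0_sparse_le:
  assumes p: "0 \<le> p" "p \<le> 1" and np: "2 * real n * p \<le> 1 / 2"
  shows "measure_pmf.prob (random_digraph n p) {G. betti 1 G \<noteq> 0} \<le> 2 * (2 * real n * p)\<^sup>2"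
proof -
  let ?P = "measure_pmf.prob (random_digraph n p)"
  let ?C = "\<lambda>k. {xs :: (nat \<times> bool) list. set xs \<subseteq> {1..n} \<times> UNIV \<and> length xs = k}"
  let ?q = "2 * real n * p"
  have fin: "finite (?C k)" for k by (rule finite_lists_length_eq) simp
  have card: "real (card (?C k)) = (2 * real n) ^ k" for k
    by (subst card_lists_length_eq) (simp_all add: card_cartesian_product mult.commute)
  have "?P {G. betti 1 G \<noteq> 0} \<le>
        ?P (\<Union>k\<in>{2..n}. \<Union>xs\<in>{xs \<in> ?C k. oriented_cycle xs}. {G. walk_arcs xs \<subseteq> parcs G})"
  proof (rule measure_pmf.finite_measure_mono_AE)
    show "AE G in random_digraph n p. G \<in> {G. betti 1 G \<noteq> 0} \<longrightarrow>
        G \<in> (\<Union>k\<in>{2..n}. \<Union>xs\<in>{xs \<in> ?C k. oriented_cycle xs}. {G. walk_arcs xs \<subseteq> parcs G})"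
      unfolding AE_measure_pmf_iff
    proof (intro ballI impI)
      fix G assume G: "G \<in> set_pmf (random_digraph n p)" and ne: "G \<in> {G. betti 1 G \<noteq> 0}"
      have "\<exists>xs. oriented_cycle xs \<and> walk_arcs xs \<subseteq> parcs G"
      proof (rule ccontr)
        assume "\<not> ?thesis"
        then have "betti 1 G = 0" by (intro betti_1_eq_0_if_no_oriented_cycle) blast
        then show False using ne by simp
      qed
      then obtain xs where xs: "oriented_cycle xs" "walk_arcs xs \<subseteq> parcs G"
        by (elim exE conjE) (rule that)
      have "fst x \<in> {1..n}" if "x \<in> set xs" for x
      proof -
        from that obtain i where i: "i < length xs" "xs ! i = x" unfolding in_set_conv_nth by blast
        have "walk_arc xs i \<in> walk_arcs xs" unfolding walk_arcs_def using i(1) by (intro imageI) simp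
        also have "\<dots> \<subseteq> all_arcs n" using xs(2) set_random_digraph(2)[OF G] by (rule subset_trans)
        finally show ?thesis by (simp add: walk_arc_def all_arcs_def Let_def i(2) split: if_splits)
      qed
      then have sub: "set (map fst xs) \<subseteq> {1..n}" by auto
      \<comment> \<open>The vertices are distinct elements of \<open>{1..n}\<close>, so only lengths
        up to \<open>n\<close> occur and the union is finite.\<close>
      have "length xs = card (set (map fst xs))"
        using xs(1) distinct_card[of "map fst xs"] by (simp add: oriented_cycle_def)
      also have "\<dots> \<le> card {1..n}" using sub by (intro card_mono) simp_all
      finally have "length xs \<in> {2..n}" using xs(1) by (simp add: oriented_cycle_def)
      moreover have "xs \<in> {ys \<in> ?C (length xs). oriented_cycle ys}"
        using sub xs(1) by (auto simp: mem_Times_iff)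
      ultimately show "G \<in> (\<Union>k\<in>{2..n}. \<Union>xs\<in>{xs \<in> ?C k. oriented_cycle xs}. {G. walk_arcs xs \<subseteq> parcs G})"
        using xs(2) by blast
    qed
  qed simp
  also have "\<dots> \<le> (\<Sum>k\<in>{2..n}. ?P (\<Union>xs\<in>{xs \<in> ?C k. oriented_cycle xs}. {G. walk_arcs xs \<subseteq> parcs G}))"
    by (rule measure_pmf.finite_measure_subadditive_finite) simp_all
  also have "\<dots> \<le> (\<Sum>k\<in>{2..n}. ?q ^ k)"
  proof (rule sum_mono)
    fix k
    have "?P (\<Union>xs\<in>{xs \<in> ?C k. oriented_cycle xs}. {G. walk_arcs xs \<subseteq> parcs G}) \<le>
          (\<Sum>xs\<in>{xs \<in> ?C k. oriented_cycle xs}. ?P {G. walk_arcs xs \<subseteq> parcs G})"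
    proof (rule measure_pmf.finite_measure_subadditive_finite)
      show "finite {xs \<in> ?C k. oriented_cycle xs}"
        by (rule finite_subset[OF _ fin[of k]]) (rule Collect_restrict)
    qed simp
    also have "\<dots> \<le> (\<Sum>xs\<in>{xs \<in> ?C k. oriented_cycle xs}. p ^ k)"
    proof (rule sum_mono)
      fix xs assume "xs \<in> {xs \<in> ?C k. oriented_cycle xs}"
      then have "card (walk_arcs xs) = k" by (simp add: oriented_cycle_def)
      then show "?P {G. walk_arcs xs \<subseteq> parcs G} \<le> p ^ k"
        using prob_arcs_present_le[OF p, of n "walk_arcs xs"] by simp
    qed
    also have "\<dots> \<le> (\<Sum>xs\<in>?C k. p ^ k)"
      using fin[of k] p by (intro sum_mono2) auto
    also have "\<dots> = ?q ^ k" using card[of k] by (simp add: power_mult_distrib)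
    finally show "?P (\<Union>xs\<in>{xs \<in> ?C k. oriented_cycle xs}. {G. walk_arcs xs \<subseteq> parcs G}) \<le> ?q ^ k" .
  qed
  \<comment> \<open>Nonnegative terms are added so that shifting the index by two gives the range
    below \<open>n\<close>.\<close>
  also have "\<dots> \<le> (\<Sum>k\<in>{2..<n + 2}. ?q ^ k)"
    using p by (intro sum_mono2) auto
  also have "\<dots> = (\<Sum>k\<in>{..<n}. ?q ^ (k + 2))"
    by (simp only: sum.shift_bounds_nat_ivl[of _ 0 2 n, unfolded add_0 atLeast0LessThan])
  also have "\<dots> = ?q\<^sup>2 * (\<Sum>k<n. ?q ^ k)"
    unfolding power_add sum_distrib_left by (intro sum.cong refl mult.commute)
  also have "\<dots> \<le> ?q\<^sup>2 * (\<Sum>k<n. (1 / 2) ^ k)"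
    using p np by (intro mult_left_mono sum_mono power_mono) simp_all
  also have "\<dots> \<le> ?q\<^sup>2 * 2"
  proof (rule mult_left_mono)
    show "(\<Sum>k<n. (1 / 2 :: real) ^ k) \<le> 2" by (simp add: sum_gp_strict)
  qed simp
  finally show ?thesis by simp
qed

text \<open>Different candidates \<open>w\<close> outside \<open>X\<close> involve disjoint sets of
  arcs, so their failures are independent, each with probability \<open>1 - p ^ card X\<close>.
  Bounding \<open>card X\<close> by 4 accommodates repeated vertices.\<close>

lemma prob_no_common_out_neighbour_le:
  assumes p: "0 \<le> p" "p \<le> 1" and X: "X \<subseteq> {1..n}" "card X \<le> 4"
  shows "measure_pmf.prob (random_digraph n p) {G. \<forall>w. \<not> (\<lambda>x. (x, w)) ` X \<subseteq> parcs G} \<le> (1 - p ^ 4) ^ (n - 4)"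
proof -
  let ?W = "{1..n} - X" and ?F = "\<lambda>w. (\<lambda>x. (x, w)) ` X"
  let ?P = "measure_pmf.prob (random_digraph n p)" and ?E = "measure_pmf.expectation (random_digraph n p)"
  have finX: "finite X" using X(1) finite_subset by blast
  have "?P {G. \<forall>w. \<not> ?F w \<subseteq> parcs G} \<le> ?P {G. \<forall>w\<in>?W. \<not> ?F w \<subseteq> parcs G}"
    by (rule measure_pmf.finite_measure_mono) auto
  also have "\<dots> = ?E (indicat_real {G. \<forall>w\<in>?W. \<not> ?F w \<subseteq> parcs G})"
    by simp
  \<comment> \<open>By inclusion and exclusion only the probabilities that given sets of arcs are present are needed.\<close>
  also have "indicat_real {G :: nat pair_pre_digraph. \<forall>w\<in>?W. \<not> ?F w \<subseteq> parcs G} =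
      (\<lambda>G :: nat pair_pre_digraph. \<Sum>Y\<in>Pow ?W. (- 1) ^ card Y * of_bool ((\<Union>w\<in>Y. ?F w) \<subseteq> parcs G))"
  proof
    fix G :: "nat pair_pre_digraph"
    have "indicat_real {G. \<forall>w\<in>?W. \<not> ?F w \<subseteq> parcs G} G = (\<Prod>w\<in>?W. 1 - of_bool (?F w \<subseteq> parcs G))"
    proof (cases "\<forall>w\<in>?W. \<not> ?F w \<subseteq> parcs G")
      case True
      then have "(\<Prod>w\<in>?W. 1 - of_bool (?F w \<subseteq> parcs G)) = (\<Prod>w\<in>?W. 1 :: real)"
        by (intro prod.cong refl) auto
      then show ?thesis using True by simp
    next
      case False
      then have "(\<Prod>w\<in>?W. 1 - of_bool (?F w \<subseteq> parcs G)) = (0 :: real)"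
        by (subst prod_zero_iff) auto
      then show ?thesis using False by simp
    qed
    also have "\<dots> = (\<Sum>Y\<in>Pow ?W. \<Prod>w\<in>Y. - of_bool (?F w \<subseteq> parcs G))"
      using prod_add[of ?W "\<lambda>w. - of_bool (?F w \<subseteq> parcs G) :: real" "\<lambda>_. 1"] by simp
    also have "\<dots> = (\<Sum>Y\<in>Pow ?W. (- 1) ^ card Y * of_bool ((\<Union>w\<in>Y. ?F w) \<subseteq> parcs G))"
    proof (intro sum.cong refl)
      fix Y assume "Y \<in> Pow ?W"
      then have Y: "finite Y" by (auto intro: finite_subset)
      have "(\<Prod>w\<in>Y. - of_bool (?F w \<subseteq> parcs G)) = (- 1) ^ card Y * (\<Prod>w\<in>Y. of_bool (?F w \<subseteq> parcs G) :: real)"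
        by (simp add: prod_uminus)
      also have "(\<Prod>w\<in>Y. of_bool (?F w \<subseteq> parcs G) :: real) = of_bool ((\<Union>w\<in>Y. ?F w) \<subseteq> parcs G)"
        using Y by induction auto
      finally show "(\<Prod>w\<in>Y. - of_bool (?F w \<subseteq> parcs G)) =
          (- 1) ^ card Y * (of_bool ((\<Union>w\<in>Y. ?F w) \<subseteq> parcs G) :: real)" .
    qed
    finally show "indicat_real {G. \<forall>w\<in>?W. \<not> ?F w \<subseteq> parcs G} G =
      (\<Sum>Y\<in>Pow ?W. (- 1) ^ card Y * of_bool ((\<Union>w\<in>Y. ?F w) \<subseteq> parcs G))" .
  qed
  also have "?E \<dots> = (\<Sum>Y\<in>Pow ?W. (- 1) ^ card Y * ?E (\<lambda>G. of_bool ((\<Union>w\<in>Y. ?F w) \<subseteq> parcs G)))"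
    by (subst Bochner_Integration.integral_sum) simp_all
  also have "\<dots> = (\<Sum>Y\<in>Pow ?W. (- (p ^ card X)) ^ card Y)"
  proof (intro sum.cong refl)
    fix Y assume "Y \<in> Pow ?W"
    then have Y: "finite Y" "Y \<subseteq> ?W" by (auto intro: finite_subset)
    \<comment> \<open>The stars at \<open>w\<close> in \<open>Y\<close> form a complete bipartite
      set of arcs, with \<open>card X * card Y\<close> elements; it has no loops because
      \<open>Y\<close> avoids \<open>X\<close>.\<close>
    have "(\<Union>w\<in>Y. ?F w) = X \<times> Y" by auto
    moreover have "X \<times> Y \<subseteq> all_arcs n" using X(1) Y(2) by (auto simp: all_arcs_def)
    ultimately have "?E (\<lambda>G. of_bool ((\<Union>w\<in>Y. ?F w) \<subseteq> parcs G)) = (p ^ card X) ^ card Y"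
      using expectation_arcs_present[OF p, of "X \<times> Y" n]
      by (simp only: card_cartesian_product power_mult)
    then show "(- 1) ^ card Y * ?E (\<lambda>G. of_bool ((\<Union>w\<in>Y. ?F w) \<subseteq> parcs G)) = (- (p ^ card X)) ^ card Y"
      by (simp only: power_minus[of "p ^ card X"])
  qed
  \<comment> \<open>The expansion over subsets of \<open>?W\<close> is read backwards as a product
    of equal factors.\<close>
  also have "\<dots> = (1 - p ^ card X) ^ card ?W"
    using prod_add[of ?W "\<lambda>_. - (p ^ card X)" "\<lambda>_. 1"] by simp
  also have "\<dots> \<le> (1 - p ^ 4) ^ card ?W"
    using p X(2) by (intro power_mono) (simp_all add: power_decreasing power_le_one)
  also have "\<dots> \<le> (1 - p ^ 4) ^ (n - 4)"
  proof (rule power_decreasing)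
    show "n - 4 \<le> card ?W" using X finX by (simp add: card_Diff_subset)
  qed (use p in \<open>simp_all add: power_le_one\<close>)
  finally show ?thesis .
qed

text \<open>A union bound over all lists of four vertices, repetitions included because the
  vanishing criterion is applied to repeated vertices as well.\<close>

lemma prob_betti_1_neq_0_dense_le:
  assumes p: "0 \<le> p" "p \<le> 1"
  shows "measure_pmf.prob (random_digraph n p) {G. betti 1 G \<noteq> 0} \<le> real n ^ 4 * (1 - p ^ 4) ^ (n - 4)"
proof -
  let ?P = "measure_pmf.prob (random_digraph n p)"
  let ?L = "{xs. set xs \<subseteq> {1..n} \<and> length xs = 4}"
  let ?bad = "\<lambda>X. {G. \<forall>w. \<not> (\<lambda>x. (x, w)) ` X \<subseteq> parcs G}"
  have fin: "finite ?L" by (rule finite_lists_length_eq) simp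
  have "?P {G. betti 1 G \<noteq> 0} \<le> ?P (\<Union>xs\<in>?L. ?bad (set xs))"
  proof (rule measure_pmf.finite_measure_mono_AE)
    show "AE G in random_digraph n p. G \<in> {G. betti 1 G \<noteq> 0} \<longrightarrow> G \<in> (\<Union>xs\<in>?L. ?bad (set xs))"
      unfolding AE_measure_pmf_iff
    proof (intro ballI impI, rule ccontr)
      fix G assume G: "G \<in> set_pmf (random_digraph n p)" and ne: "G \<in> {G. betti 1 G \<noteq> 0}"
        and good: "G \<notin> (\<Union>xs\<in>?L. ?bad (set xs))"
      note G' = set_random_digraph[OF G]
      have "dFl_cycles 1 G \<subseteq> dFl_boundaries 1 G"
      proof (rule dFl_cycles_1_subset_boundaries)
        show "a \<in> pverts G \<and> b \<in> pverts G \<and> a \<noteq> b" if "(a, b) \<in> parcs G" for a b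
          using that G' by (auto simp: all_arcs_def)
        fix a b c d assume "{a, b, c, d} \<subseteq> pverts G"
        then have "[a, b, c, d] \<in> ?L" using G'(1) by simp
        then have "G \<notin> ?bad (set [a, b, c, d])" using good by blast
        then show "\<exists>w. {(a, w), (b, w), (c, w), (d, w)} \<subseteq> parcs G" by auto
      qed
      from betti_1_eq_0[OF this] show False using ne by simp
    qed
  qed simp
  also have "\<dots> \<le> (\<Sum>xs\<in>?L. ?P (?bad (set xs)))"
    using fin by (intro measure_pmf.finite_measure_subadditive_finite) simp_all
  also have "\<dots> \<le> (\<Sum>xs\<in>?L. (1 - p ^ 4) ^ (n - 4))"
  proof (rule sum_mono)
    fix xs :: "nat list" assume "xs \<in> ?L"
    then show "?P (?bad (set xs)) \<le> (1 - p ^ 4) ^ (n - 4)"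
      using card_length[of xs] by (intro prob_no_common_out_neighbour_le[OF p]) auto
  qed
  also have "\<dots> = real n ^ 4 * (1 - p ^ 4) ^ (n - 4)"
    using card_lists_length_eq[of "{1..n}" 4] by simp
  finally show ?thesis .
qed

section \<open>Asymptotics\<close>

lemma tendsto_prob_1:
  fixes D :: "nat \<Rightarrow> 'a pmf"
  assumes "\<forall>\<^sub>F n in sequentially. measure_pmf.prob (D n) {x. \<not> Q x} \<le> b n" "b \<longlonglongrightarrow> 0"
  shows "(\<lambda>n. measure_pmf.prob (D n) {x. Q x}) \<longlonglongrightarrow> 1"
proof (rule tendsto_sandwich)
  have "measure_pmf.prob (D n) {x. Q x} = 1 - measure_pmf.prob (D n) {x. \<not> Q x}" for n
    using measure_pmf.prob_compl[of "{x. \<not> Q x}" "D n"] by (simp add: Compl_eq_Diff_UNIV[symmetric] Collect_neg_eq)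
  then have compl: "measure_pmf.prob (D n) {x. \<not> Q x} = 1 - measure_pmf.prob (D n) {x. Q x}" for n
    by simp
  from assms(1) show "\<forall>\<^sub>F n in sequentially. 1 - b n \<le> measure_pmf.prob (D n) {x. Q x}"
    unfolding compl by eventually_elim simp
  show "(\<lambda>n. 1 - b n) \<longlonglongrightarrow> 1" using tendsto_diff[OF tendsto_const assms(2), of 1] by simp
  show "\<forall>\<^sub>F n in sequentially. measure_pmf.prob (D n) {x. Q x} \<le> 1" by simp
qed simp

lemma tendsto_sequentially_neg_powr:
  assumes "s < 0"
  shows "(\<lambda>n. real n powr s) \<longlonglongrightarrow> 0"
  using tendsto_neg_powr[OF assms filterlim_real_sequentially] .

lemma mean_arcs_ge:
  fixes n :: nat and p :: real
  assumes "2 \<le> n" "0 \<le> p"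
  shows "(real n)\<^sup>2 * p / 2 \<le> real n * (real n - 1) * p"
proof -
  have "real n * (real n / 2) * p \<le> real n * (real n - 1) * p"
    using assms by (intro mult_right_mono mult_left_mono) auto
  then show ?thesis by (simp add: power2_eq_square)
qed

text \<open>The relative error is at most twice \<open>1 / (n * p)\<close> plus twice
  \<open>n * p ^ 2\<close>, the factor 2 coming from \<open>n - 1\<close> being at least
  \<open>n / 2\<close>. Both exponents are negative exactly for \<alpha> strictly between -1 and
  -1/2.\<close>

lemma mean_arcs_error_le:
  fixes n :: nat and \<alpha> :: real
  assumes "2 \<le> n"
  defines "p \<equiv> real n powr \<alpha>"
  shows "(real n + real n ^ 3 * p ^ 3) / (real n * (real n - 1) * p)
           \<le> 2 * real n powr (- 1 - \<alpha>) + 2 * real n powr (1 + 2 * \<alpha>)"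
proof -
  have p: "0 < p" using assms by (simp add: p_def)
  have "(real n + real n ^ 3 * p ^ 3) / (real n * (real n - 1) * p) \<le>
        (real n + real n ^ 3 * p ^ 3) / ((real n)\<^sup>2 * p / 2)"
    using assms(1) p mean_arcs_ge[of n p] by (intro divide_left_mono) auto
  also have "\<dots> = 2 * (1 / (real n * p)) + 2 * (real n * p\<^sup>2)"
    using p assms(1) by (simp add: field_simps power2_eq_square power3_eq_cube)
  also have "1 / (real n * p) = real n powr (- 1 - \<alpha>)"
    using assms(1) by (simp add: p_def powr_diff powr_minus field_simps)
  also have "real n * p\<^sup>2 = real n powr (1 + 2 * \<alpha>)"
    using assms(1) unfolding p_def power2_eq_square mult_2 powr_add by simp
  finally show ?thesis .
qed

lemma powr_nonpos_le_1:
  assumes "\<alpha> \<le> 0"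
  shows "0 \<le> real n powr \<alpha>" "real n powr \<alpha> \<le> 1"
proof -
  show "real n powr \<alpha> \<le> 1"
    using assms powr_mono[of \<alpha> 0 "real n"] by (cases "n = 0") auto
qed simp

lemma expectation_betti_1_asymp:
  assumes "-1 < \<alpha>" "\<alpha> < -1/2"
  shows "(\<lambda>n. measure_pmf.expectation (random_digraph n (real n powr \<alpha>)) (\<lambda>G. real (betti 1 G)) /
           (real n * (real n - 1) * real n powr \<alpha>)) \<longlonglongrightarrow> 1"
proof (rule tendsto_sandwich)
  let ?E = "\<lambda>n. measure_pmf.expectation (random_digraph n (real n powr \<alpha>)) (\<lambda>G. real (betti 1 G))"
  let ?\<mu> = "\<lambda>n. real n * (real n - 1) * real n powr \<alpha>"
  let ?err = "\<lambda>n. 2 * real n powr (- 1 - \<alpha>) + 2 * real n powr (1 + 2 * \<alpha>)"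
  have p: "0 \<le> real n powr \<alpha>" "real n powr \<alpha> \<le> 1" for n
    using assms by (simp_all add: powr_nonpos_le_1 del: powr_ge_zero)
  have pos: "0 < ?\<mu> n" if "2 \<le> n" for n using that by simp
  have frac: "1 - (a + b) / m = (m - a - b) / m" if "0 < m" for a b m :: real
    using that by (simp add: field_simps)
  show "\<forall>\<^sub>F n in sequentially. 1 - ?err n \<le> ?E n / ?\<mu> n"
    using eventually_ge_at_top[of 2]
  proof eventually_elim
    case (elim n)
    have "1 - ?err n \<le> 1 - (real n + real n ^ 3 * (real n powr \<alpha>) ^ 3) / ?\<mu> n"
      using mean_arcs_error_le[OF elim, of \<alpha>] by simp
    also have "\<dots> = (?\<mu> n - real n - real n ^ 3 * (real n powr \<alpha>) ^ 3) / ?\<mu> n"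
      by (rule frac[OF pos[OF elim]])
    also have "\<dots> \<le> ?E n / ?\<mu> n"
      using expectation_betti_1_ge[OF p, of n n] pos[OF elim] by (intro divide_right_mono) simp_all
    finally show ?case .
  qed
  show "\<forall>\<^sub>F n in sequentially. ?E n / ?\<mu> n \<le> 1"
    using eventually_ge_at_top[of 2]
  proof eventually_elim
    case (elim n)
    show ?case unfolding divide_le_eq_1_pos[OF pos[OF elim]] by (rule expectation_betti_1_le[OF p])
  qed
  have "(\<lambda>n. 1 - ?err n) \<longlonglongrightarrow> 1 - (2 * 0 + 2 * 0)"
    using assms by (intro tendsto_intros tendsto_sequentially_neg_powr) auto
  then show "(\<lambda>n. 1 - ?err n) \<longlonglongrightarrow> 1" by simp
qed simp

lemma betti_1_pos_whp:
  assumes "-1 < \<alpha>" "\<alpha> < -1/2"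
  shows "(\<lambda>n. measure_pmf.prob (random_digraph n (real n powr \<alpha>)) {G. betti 1 G > 0}) \<longlonglongrightarrow> 1"
proof (rule tendsto_prob_1)
  let ?p = "\<lambda>n. real n powr \<alpha>"
  let ?\<mu> = "\<lambda>n. real n * (real n - 1) * ?p n"
  let ?err = "\<lambda>n. 4 * (2 * real n powr (- 1 - \<alpha>) + 2 * real n powr (1 + 2 * \<alpha>))"
  have p: "0 \<le> ?p n" "?p n \<le> 1" for n
    using assms by (simp_all add: powr_nonpos_le_1 del: powr_ge_zero)
  have "0 < 1 + \<alpha>" using assms(1) by simp
  then have "filterlim (\<lambda>n. real n powr (1 + \<alpha>)) at_top sequentially" by real_asymp
  \<comment> \<open>From \<open>n * p\<close> at least 8, half of \<open>n ^ 2 * p\<close> is at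
    least \<open>4 * n\<close>; together with \<open>mean_arcs_ge\<close> this is the hypothesis of
    \<open>prob_betti_1_eq_0_le\<close>.\<close>
  then have "\<forall>\<^sub>F n in sequentially. 8 \<le> real n powr (1 + \<alpha>)"
    by (simp add: filterlim_at_top)
  with eventually_ge_at_top[of 2]
  show "\<forall>\<^sub>F n in sequentially. measure_pmf.prob (random_digraph n (?p n)) {G. \<not> 0 < betti 1 G} \<le> ?err n"
  proof eventually_elim
    case (elim n)
    have pos: "0 < ?\<mu> n" using elim(1) by simp
    have "8 \<le> real n * ?p n" using elim by (simp add: powr_add)
    then have "real n * 8 \<le> real n * (real n * ?p n)" by (intro mult_left_mono) simp_all
    then have "4 * real n \<le> ?\<mu> n"
      using mean_arcs_ge[OF elim(1), of "?p n"] p by (simp add: power2_eq_square mult.assoc)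
    then have "measure_pmf.prob (random_digraph n (?p n)) {G. betti 1 G = 0} \<le>
        4 / ?\<mu> n + 4 * (real n ^ 3 * ?p n ^ 3) / ?\<mu> n"
      using prob_betti_1_eq_0_le[OF p pos] by simp
    \<comment> \<open>Enlarging 4 to \<open>4 * n\<close> puts the bound in the shape of
      \<open>mean_arcs_error_le\<close>.\<close>
    also have "\<dots> \<le> (4 * real n + 4 * (real n ^ 3 * ?p n ^ 3)) / ?\<mu> n"
      unfolding add_divide_distrib[symmetric] using elim(1) pos by (intro divide_right_mono) simp_all
    also have "\<dots> = 4 * ((real n + real n ^ 3 * ?p n ^ 3) / ?\<mu> n)" by (simp add: algebra_simps)
    also have "\<dots> \<le> ?err n" by (intro mult_left_mono mean_arcs_error_le[OF elim(1)]) simp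
    finally show ?case by simp
  qed
  have "?err \<longlonglongrightarrow> 4 * (2 * 0 + 2 * 0)"
    using assms by (intro tendsto_intros tendsto_sequentially_neg_powr) auto
  then show "?err \<longlonglongrightarrow> 0" by simp
qed

lemma betti_1_eq_0_whp_sparse:
  assumes "\<alpha> < -1"
  shows "(\<lambda>n. measure_pmf.prob (random_digraph n (real n powr \<alpha>)) {G. betti 1 G = 0}) \<longlonglongrightarrow> 1"
proof (rule tendsto_prob_1)
  let ?p = "\<lambda>n. real n powr \<alpha>"
  have p: "0 \<le> ?p n" "?p n \<le> 1" for n
    using assms by (simp_all add: powr_nonpos_le_1 del: powr_ge_zero)
  have 1: "(\<lambda>n. 2 * real n powr (1 + \<alpha>)) \<longlonglongrightarrow> 2 * 0"
    using assms by (intro tendsto_intros tendsto_sequentially_neg_powr) auto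
  have 2: "\<forall>\<^sub>F n in sequentially. 2 * real n powr (1 + \<alpha>) = 2 * real n * ?p n"
    using eventually_ge_at_top[of 1] by eventually_elim (simp add: powr_add)
  have lim: "(\<lambda>n. 2 * real n * ?p n) \<longlonglongrightarrow> 0"
    using Lim_transform_eventually[OF 1 2] by simp
  then have "\<forall>\<^sub>F n in sequentially. 2 * real n * ?p n < 1 / 2" by (rule order_tendstoD) simp
  then show "\<forall>\<^sub>F n in sequentially. measure_pmf.prob (random_digraph n (?p n)) {G. betti 1 G \<noteq> 0}
      \<le> 2 * (2 * real n * ?p n)\<^sup>2"
    by eventually_elim (rule prob_betti_1_neq_0_sparse_le[OF p], simp)
  have "(\<lambda>n. 2 * (2 * real n * ?p n)\<^sup>2) \<longlonglongrightarrow> 2 * 0\<^sup>2" by (intro tendsto_intros lim)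
  then show "(\<lambda>n. 2 * (2 * real n * ?p n)\<^sup>2) \<longlonglongrightarrow> 0" by simp
qed

lemma betti_1_eq_0_whp_dense:
  assumes "\<alpha> \<le> 0" "-1/4 < \<alpha>"
  shows "(\<lambda>n. measure_pmf.prob (random_digraph n (real n powr \<alpha>)) {G. betti 1 G = 0}) \<longlonglongrightarrow> 1"
proof (rule tendsto_prob_1)
  let ?p = "\<lambda>n. real n powr \<alpha>"
  \<comment> \<open>The exponent of \<open>n * p ^ 4\<close>, half of which bounds the expected
    number of common out-neighbours from below.\<close>
  define \<delta> where "\<delta> = 1 + 4 * \<alpha>"
  have \<delta>: "\<delta> > 0" using assms by (simp add: \<delta>_def)
  have p: "0 \<le> ?p n" "?p n \<le> 1" for n
    using assms(1) by (simp_all add: powr_nonpos_le_1 del: powr_ge_zero)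
  show "\<forall>\<^sub>F n in sequentially. measure_pmf.prob (random_digraph n (?p n)) {G. betti 1 G \<noteq> 0}
      \<le> real n ^ 4 * exp (- (real n powr \<delta>) / 2)"
    \<comment> \<open>From 8 on, \<open>n - 4\<close> is at least \<open>n / 2\<close>.\<close>
    using eventually_ge_at_top[of 8]
  proof eventually_elim
    case (elim n)
    have "(1 - ?p n ^ 4) ^ (n - 4) \<le> exp (- (?p n ^ 4)) ^ (n - 4)"
      using exp_ge_add_one_self[of "- (?p n ^ 4)"] p by (intro power_mono) (simp_all add: power_le_one)
    also have "\<dots> = exp (- (real (n - 4) * ?p n ^ 4))"
      by (simp flip: exp_of_nat_mult)
    also have "\<dots> \<le> exp (- (real n / 2 * ?p n ^ 4))"
      using elim by (intro iffD2[OF exp_le_cancel_iff] le_imp_neg_le mult_right_mono) (simp_all add: of_nat_diff)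
    also have "real n / 2 * ?p n ^ 4 = real n powr \<delta> / 2"
      using elim by (simp add: \<delta>_def powr_add powr_power mult.commute)
    finally have "(1 - ?p n ^ 4) ^ (n - 4) \<le> exp (- (real n powr \<delta>) / 2)" by simp
    then have "real n ^ 4 * (1 - ?p n ^ 4) ^ (n - 4) \<le> real n ^ 4 * exp (- (real n powr \<delta>) / 2)"
      by (intro mult_left_mono) simp_all
    with prob_betti_1_neq_0_dense_le[OF p, of n n] show ?case by linarith
  qed
  show "(\<lambda>n. real n ^ 4 * exp (- (real n powr \<delta>) / 2)) \<longlonglongrightarrow> 0"
    using \<delta> by real_asymp
qed

theorem theorem5p8:
  fixes \<alpha> :: real
  assumes "\<alpha> \<le> 0"
  shows
    "(-1 < \<alpha> \<and> \<alpha> < -1/2 \<longrightarrow>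
        (\<lambda>n. measure_pmf.expectation (random_digraph n (real n powr \<alpha>)) (\<lambda>G. real (betti 1 G)) /
               (real n * (real n - 1) * real n powr \<alpha>)) \<longlonglongrightarrow> 1) \<and>
     (-1 < \<alpha> \<and> \<alpha> < -1/2 \<longrightarrow>
        (\<lambda>n. measure_pmf.prob (random_digraph n (real n powr \<alpha>)) {G. betti 1 G > 0}) \<longlonglongrightarrow> 1) \<and>
     (\<alpha> < -1 \<longrightarrow>
        (\<lambda>n. measure_pmf.prob (random_digraph n (real n powr \<alpha>)) {G. betti 1 G = 0}) \<longlonglongrightarrow> 1) \<and>
     (\<alpha> > -1/4 \<longrightarrow>
        (\<lambda>n. measure_pmf.prob (random_digraph n (real n powr \<alpha>)) {G. betti 1 G = 0}) \<longlonglongrightarrow> 1)"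
  using expectation_betti_1_asymp[of \<alpha>] betti_1_pos_whp[of \<alpha>]
    betti_1_eq_0_whp_sparse[of \<alpha>] betti_1_eq_0_whp_dense[OF assms] by blast

end
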